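(* Let $a_1,\ldots,a_{n-1},b_1,\ldots,b_{n-1}\in\mathbb Z_{\ge0}$ and consider the monoid on $\mathbb A^n$ with multiplication $$(x_1,\ldots,x_n)*(y_1,\ldots,y_n)=\bigl(x_1y_1,\ldots,x_{n-1}y_{n-1},\ x_1^{a_1}\cdots x_{n-1}^{a_{n-1}}y_n+y_1^{b_1}\cdots y_{n-1}^{b_{n-1}}x_n\bigr).$$ If this monoid is noncommutative, then its center equals $$Z(\mathbb A^n)=\{x_n=0,\ \ x_1^{a_1}\cdots x_{n-1}^{a_{n-1}}=x_1^{b_1}\cdots x_{n-1}^{b_{n-1}}\}.$$ In particular, all irreducible components of $Z(\mathbb A^n)$ are of dimension $n-2$.
   Context: The ground field $\mathbb K$ is algebraically closed of characteristic zero. The center of a monoid $X$ is $Z(X)=\{x\in X\mid x*y=y*x\ \forall y\in X\}$. *)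

theory Defs
  imports
    "HOL-Analysis.Abstract_Topology"
    "HOL-Algebra.Group"
    "HOL-Computational_Algebra.Polynomial"
    "HOL-Library.Extended_Nat"
begin

section \<open>Irreducibility and Krull dimension of topological spaces\<close>

definition irreducible_space :: "'a topology \<Rightarrow> bool" where
  "irreducible_space X \<longleftrightarrow> topspace X \<noteq> {} \<and>
     (\<forall>C D. closedin X C \<longrightarrow> closedin X D \<longrightarrow> topspace X = C \<union> D \<longrightarrow>
        topspace X = C \<or> topspace X = D)"

definition irreducible_components :: "'a topology \<Rightarrow> 'a set set" where
  "irreducible_components X =
     {C. C \<subseteq> topspace X \<and> irreducible_space (subtopology X C) \<and>
         (\<forall>D. D \<subseteq> topspace X \<longrightarrow> irreducible_space (subtopology X D) \<longrightarrow> C \<subseteq> D \<longrightarrow> D = C)}"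

text \<open>
  The supremum of the lengths \<open>k\<close> of strictly increasing chains
  \<open>C 0 \<subset> C 1 \<subset> \<dots> \<subset> C k\<close> of irreducible closed subsets.
  With values in \<^typ>\<open>enat\<close>, the empty space gets dimension \<open>0\<close>
  (instead of the usual \<open>-\<infinity>\<close> or \<open>-1\<close>); irreducible spaces are nonempty.
\<close>

definition krull_dim :: "'a topology \<Rightarrow> enat" where
  "krull_dim X = Sup {enat k | k. \<exists>C :: nat \<Rightarrow> 'a set.
     (\<forall>i\<le>k. closedin X (C i) \<and> irreducible_space (subtopology X (C i))) \<and>
     (\<forall>i<k. C i \<subset> C (Suc i))}"

section \<open>Affine space with the Zariski topology\<close>

text \<open>
  A point \<open>(x\<^sub>1, \<dots>, x\<^sub>n)\<close> is a function on \<open>{1..n}\<close>, extended by \<^term>\<open>undefined\<close>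
  so that equality of points is equality of coordinates.
\<close>

definition affine_space :: "nat \<Rightarrow> (nat \<Rightarrow> 'k) set" where
  "affine_space n = {1..n} \<rightarrow>\<^sub>E UNIV"

text \<open>The algebra of functions generated by the constants and the coordinates \<open>x\<^sub>1, \<dots>, x\<^sub>n\<close>.\<close>

inductive_set poly_funs :: "nat \<Rightarrow> ((nat \<Rightarrow> 'k::comm_ring_1) \<Rightarrow> 'k) set" for n where
  const: "(\<lambda>x. c) \<in> poly_funs n"
| coord: "i \<in> {1..n} \<Longrightarrow> (\<lambda>x. x i) \<in> poly_funs n"
| add: "f \<in> poly_funs n \<Longrightarrow> g \<in> poly_funs n \<Longrightarrow> (\<lambda>x. f x + g x) \<in> poly_funs n"
| mult: "f \<in> poly_funs n \<Longrightarrow> g \<in> poly_funs n \<Longrightarrow> (\<lambda>x. f x * g x) \<in> poly_funs n"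

definition zero_locus :: "nat \<Rightarrow> ((nat \<Rightarrow> 'k::comm_ring_1) \<Rightarrow> 'k) set \<Rightarrow> (nat \<Rightarrow> 'k) set" where
  "zero_locus n P = {x \<in> affine_space n. \<forall>f\<in>P. f x = 0}"

definition zariski :: "nat \<Rightarrow> (nat \<Rightarrow> 'k::idom) topology" where
  "zariski n = topology (\<lambda>U. \<exists>P\<subseteq>poly_funs n. U = affine_space n - zero_locus n P)"

lemma istopology_zariski:
  "istopology (\<lambda>U :: (nat \<Rightarrow> 'k::idom) set. \<exists>P\<subseteq>poly_funs n. U = affine_space n - zero_locus n P)"
  unfolding istopology_def
proof (intro conjI allI impI)
  fix S T :: "(nat \<Rightarrow> 'k) set"
  assume "\<exists>P\<subseteq>poly_funs n. S = affine_space n - zero_locus n P"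
    and "\<exists>P\<subseteq>poly_funs n. T = affine_space n - zero_locus n P"
  then obtain P Q where PQ: "P \<subseteq> poly_funs n" "Q \<subseteq> poly_funs n"
    and ST: "S = affine_space n - zero_locus n P" "T = affine_space n - zero_locus n Q"
    by blast
  let ?R = "(\<lambda>(f, g) x. f x * g x) ` (P \<times> Q)"
  have "?R \<subseteq> poly_funs n" using PQ by (auto intro: poly_funs.mult)
  moreover have "S \<inter> T = affine_space n - zero_locus n ?R"
  proof (rule Set.set_eqI)
    fix x
    have "(\<forall>h\<in>?R. h x = 0) \<longleftrightarrow> (\<forall>f\<in>P. \<forall>g\<in>Q. f x * g x = 0)" by auto
    then show "x \<in> S \<inter> T \<longleftrightarrow> x \<in> affine_space n - zero_locus n ?R"
      unfolding ST zero_locus_def by auto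
  qed
  ultimately show "\<exists>P\<subseteq>poly_funs n. S \<inter> T = affine_space n - zero_locus n P" by blast
next
  fix \<U> :: "(nat \<Rightarrow> 'k) set set"
  assume "\<forall>U\<in>\<U>. \<exists>P\<subseteq>poly_funs n. U = affine_space n - zero_locus n P"
  then obtain P where P: "\<And>U. U \<in> \<U> \<Longrightarrow> P U \<subseteq> poly_funs n"
      "\<And>U. U \<in> \<U> \<Longrightarrow> U = affine_space n - zero_locus n (P U)"
    by metis
  have "(\<Union>U\<in>\<U>. P U) \<subseteq> poly_funs n" using P(1) by blast
  moreover have "\<Union>\<U> = (\<Union>U\<in>\<U>. affine_space n - zero_locus n (P U))" using P(2) by auto
  then have "\<Union>\<U> = affine_space n - zero_locus n (\<Union>U\<in>\<U>. P U)"
    unfolding zero_locus_def by auto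
  ultimately show "\<exists>P\<subseteq>poly_funs n. \<Union>\<U> = affine_space n - zero_locus n P" by blast
qed

lemma openin_zariski:
  "openin (zariski n) U \<longleftrightarrow> (\<exists>P\<subseteq>poly_funs n. U = affine_space n - zero_locus n P)"
  unfolding zariski_def by (simp add: topology_inverse'[OF istopology_zariski])

lemma topspace_zariski: "topspace (zariski n) = (affine_space n :: (nat \<Rightarrow> 'k::idom) set)"
proof
  show "topspace (zariski n) \<subseteq> (affine_space n :: (nat \<Rightarrow> 'k) set)"
    using openin_topspace[of "zariski n"] unfolding openin_zariski by blast
  have "affine_space n = affine_space n - zero_locus n {\<lambda>x :: nat \<Rightarrow> 'k. 1}"
    by (simp add: zero_locus_def)
  moreover have "{\<lambda>x :: nat \<Rightarrow> 'k. 1} \<subseteq> poly_funs n" by (simp add: poly_funs.const)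
  ultimately show "(affine_space n :: (nat \<Rightarrow> 'k) set) \<subseteq> topspace (zariski n)"
    using openin_zariski openin_subset by metis
qed

lemma closedin_zariski:
  "closedin (zariski n) C \<longleftrightarrow> (\<exists>P\<subseteq>poly_funs n. C = zero_locus n P)"
proof -
  have "zero_locus n P \<subseteq> affine_space n" for P :: "((nat \<Rightarrow> 'a) \<Rightarrow> 'a) set"
    by (auto simp: zero_locus_def)
  then show ?thesis unfolding closedin_def openin_zariski topspace_zariski
    by (metis double_diff order_refl)
qed

section \<open>The monoid\<close>

definition monoid_center :: "('a, 'b) monoid_scheme \<Rightarrow> 'a set" where
  "monoid_center M = {x \<in> carrier M. \<forall>y\<in>carrier M. x \<otimes>\<^bsub>M\<^esub> y = y \<otimes>\<^bsub>M\<^esub> x}"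

definition monomial :: "nat \<Rightarrow> (nat \<Rightarrow> nat) \<Rightarrow> (nat \<Rightarrow> 'k::comm_ring_1) \<Rightarrow> 'k" where
  "monomial n a x = (\<Prod>i\<in>{1..<n}. x i ^ a i)"

definition affine_monoid ::
  "nat \<Rightarrow> (nat \<Rightarrow> nat) \<Rightarrow> (nat \<Rightarrow> nat) \<Rightarrow> (nat \<Rightarrow> 'k::comm_ring_1) monoid" where
  "affine_monoid n a b =
     \<lparr> carrier = affine_space n,
       monoid.mult = (\<lambda>x y. \<lambda>i\<in>{1..n}.
         if i < n then x i * y i else monomial n a x * y n + monomial n b y * x n),
       one = (\<lambda>i\<in>{1..n}. if i < n then 1 else 0) \<rparr>"

lemma monoid_affine_monoid:
  assumes "n \<ge> 1"
  shows "monoid (affine_monoid n a b :: (nat \<Rightarrow> 'k::comm_ring_1) monoid)"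
proof -
  let ?M = "affine_monoid n a b :: (nat \<Rightarrow> 'k) monoid"
  have mult: "x \<otimes>\<^bsub>?M\<^esub> y = (\<lambda>i\<in>{1..n}.
      if i < n then x i * y i else monomial n a x * y n + monomial n b y * x n)" for x y
    by (simp add: affine_monoid_def)
  have mon_mult: "monomial n c (x \<otimes>\<^bsub>?M\<^esub> y) = monomial n c x * monomial n c y" for c x y
    unfolding monomial_def mult prod.distrib[symmetric]
    by (rule prod.cong) (auto simp: power_mult_distrib)
  have mon_one: "monomial n c \<one>\<^bsub>?M\<^esub> = 1" for c
    unfolding monomial_def affine_monoid_def by (rule prod.neutral) auto
  show ?thesis
  proof (rule monoidI)
    fix x y z :: "nat \<Rightarrow> 'k"
    show "x \<otimes>\<^bsub>?M\<^esub> y \<otimes>\<^bsub>?M\<^esub> z = x \<otimes>\<^bsub>?M\<^esub> (y \<otimes>\<^bsub>?M\<^esub> z)"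
    proof
      fix i
      show "(x \<otimes>\<^bsub>?M\<^esub> y \<otimes>\<^bsub>?M\<^esub> z) i = (x \<otimes>\<^bsub>?M\<^esub> (y \<otimes>\<^bsub>?M\<^esub> z)) i"
        using assms
        by (subst (1 3) mult) (auto simp: mon_mult, auto simp: mult algebra_simps)
    qed
  next
    fix x y :: "nat \<Rightarrow> 'k"
    show "x \<otimes>\<^bsub>?M\<^esub> y \<in> carrier ?M"
      by (auto simp: mult) (auto simp: affine_monoid_def affine_space_def)
  next
    show "\<one>\<^bsub>?M\<^esub> \<in> carrier ?M" by (auto simp: affine_monoid_def affine_space_def)
  next
    fix x assume "x \<in> carrier ?M"
    then have x: "i \<notin> {1..n} \<Longrightarrow> x i = undefined" for i
      by (auto simp: affine_monoid_def affine_space_def)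
    have one: "i \<in> {1..n} \<Longrightarrow> \<one>\<^bsub>?M\<^esub> i = (if i < n then 1 else 0)" for i
      by (auto simp: affine_monoid_def)
    show "\<one>\<^bsub>?M\<^esub> \<otimes>\<^bsub>?M\<^esub> x = x" "x \<otimes>\<^bsub>?M\<^esub> \<one>\<^bsub>?M\<^esub> = x"
      using assms x by (auto simp: mult mon_one one fun_eq_iff)
  qed
qed

end

theory Submission
  imports Defs "HOL-Library.Function_Algebras"
begin

text \<open>
  Noncommutativity gives an index \<open>i0 < n\<close> with \<open>a i0 \<noteq> b i0\<close>.  Two elements commute if and only
  if their products agree in the last coordinate, and a few test elements turn this condition
  into the equations \<open>x n = 0\<close> and \<open>x\<^sup>a = x\<^sup>b\<close> (lemma \<open>center_affine_monoid\<close>).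

  The dimension of the components is computed from an explicit description.  The solutions of
  \<open>x\<^sup>a = x\<^sup>b\<close> with nonzero coordinates are covered by finitely many images of a torus of
  dimension \<open>n - 2\<close>, one for each root of unity of order dividing \<open>\<bar>a i0 - b i0\<bar>\<close>.  The
  other solutions either lie in a coordinate subspace \<open>x j = x n = 0\<close> with \<open>a j\<close> and \<open>b j\<close> both
  positive, which is contained in the locus and is again the closure of an image of such a torus,
  or they are limits of solutions with nonzero coordinates.  So the locus is a finite union
  of closures of toric images (lemma \<open>binomial_locus_cover\<close>).  These closures are irreducible,
  hence every component is one of them.

  The closure of a toric image has dimension at least \<open>n - 2\<close>, because the torus contains a
  flag of subtori whose images have distinct closures (lemma \<open>krull_dim_toric_closure_ge\<close>).
  For the upper bound, a chain of irreducible closed subsets of the locus can be extended by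
  the hyperplane \<open>x n = 0\<close> and by affine space, and chains in affine space have length at
  most \<open>n\<close> (lemma \<open>chain_length_le\<close>): a chain of length \<open>k\<close> provides \<open>k\<close> algebraically
  independent polynomials in \<open>n\<close> variables, and counting monomials shows \<open>k \<le> n\<close>.

  Irreducibility and density are both proved with rational curves, so that the only polynomials
  whose roots matter are polynomials in one variable.
\<close>

section \<open>Irreducible sets and closures in affine space\<close>

lemma poly_funs_power: "f \<in> poly_funs n \<Longrightarrow> (\<lambda>x. f x ^ k) \<in> poly_funs n"
  by (induction k) (auto intro: poly_funs.intros)

lemma poly_funs_prod:
  "(\<And>i. i \<in> I \<Longrightarrow> f i \<in> poly_funs n) \<Longrightarrow> (\<lambda>x. \<Prod>i\<in>I. f i x) \<in> poly_funs n"
  by (induction I rule: infinite_finite_induct) (auto intro: poly_funs.intros)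

lemma poly_funs_sum:
  "(\<And>i. i \<in> I \<Longrightarrow> f i \<in> poly_funs n) \<Longrightarrow> (\<lambda>x. \<Sum>i\<in>I. f i x) \<in> poly_funs n"
  by (induction I rule: infinite_finite_induct) (auto intro: poly_funs.intros)

lemma monomial_in_poly_funs: "monomial n a \<in> poly_funs n"
  unfolding monomial_def by (intro poly_funs_prod poly_funs_power poly_funs.coord) auto

text \<open>
  Irreducibility of \<open>X\<close> in algebraic form: the polynomial functions restricted to \<open>X\<close>
  form an integral domain.  Chains are handled through functions, so this form is the
  convenient one; it makes sense for sets that are not closed, such as images of tori.
\<close>

definition integral_on :: "nat \<Rightarrow> (nat \<Rightarrow> 'k::idom) set \<Rightarrow> bool" where
  "integral_on n X \<longleftrightarrow> X \<noteq> {} \<and>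
     (\<forall>f\<in>poly_funs n. \<forall>g\<in>poly_funs n. (\<forall>x\<in>X. f x * g x = 0) \<longrightarrow>
        (\<forall>x\<in>X. f x = 0) \<or> (\<forall>x\<in>X. g x = 0))"

lemma integral_onD:
  assumes "integral_on n X" "f \<in> poly_funs n" "g \<in> poly_funs n" "\<And>x. x \<in> X \<Longrightarrow> f x * g x = 0"
  shows "(\<forall>x\<in>X. f x = 0) \<or> (\<forall>x\<in>X. g x = 0)"
  using assms unfolding integral_on_def by blast

lemma integral_on_subset_Un:
  assumes "integral_on n X" "closedin (zariski n) C" "closedin (zariski n) D" "X \<subseteq> C \<union> D"
  shows "X \<subseteq> C \<or> X \<subseteq> D"
proof (rule ccontr)
  assume "\<not> (X \<subseteq> C \<or> X \<subseteq> D)"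
  then obtain x y where xy: "x \<in> X" "x \<notin> C" "y \<in> X" "y \<notin> D" by blast
  obtain P Q where PQ: "P \<subseteq> poly_funs n" "Q \<subseteq> poly_funs n" "C = zero_locus n P" "D = zero_locus n Q"
    using assms(2,3) unfolding closedin_zariski by blast
  have "X \<subseteq> affine_space n" using assms(4) PQ by (auto simp: zero_locus_def)
  then obtain f g where fg: "f \<in> P" "f x \<noteq> 0" "g \<in> Q" "g y \<noteq> 0"
    using xy PQ by (auto simp: zero_locus_def)
  have "f z * g z = 0" if "z \<in> X" for z
    using that assms(4) fg PQ by (auto simp: zero_locus_def)
  then show False using integral_onD[OF assms(1), of f g] fg PQ xy by blast
qed

text \<open>
  Splitting off one closed set at a time.  With a finite cover by irreducible closed sets, this
  identifies the irreducible components of a space.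
\<close>

lemma integral_on_subset_Union:
  assumes "finite I" "integral_on n X" "\<And>i. i \<in> I \<Longrightarrow> closedin (zariski n) (C i)"
    "X \<subseteq> (\<Union>i\<in>I. C i)"
  shows "\<exists>i\<in>I. X \<subseteq> C i"
  using assms(1,3,4)
proof (induction I rule: finite_induct)
  case empty
  then show ?case using assms(2) by (auto simp: integral_on_def)
next
  case (insert i I)
  have "closedin (zariski n) (\<Union>i\<in>I. C i)"
    using insert by (intro closedin_Union) auto
  then have "X \<subseteq> C i \<or> X \<subseteq> (\<Union>i\<in>I. C i)"
    using integral_on_subset_Un[OF assms(2), of "C i" "\<Union>i\<in>I. C i"] insert.prems by auto
  then show ?case using insert by auto
qed

lemma irreducible_space_zariski_iff:
  fixes X :: "(nat \<Rightarrow> 'k::idom) set"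
  assumes "X \<subseteq> affine_space n"
  shows "irreducible_space (subtopology (zariski n) X) \<longleftrightarrow> integral_on n X"
proof -
  have ts: "topspace (subtopology (zariski n) X) = X"
    using assms by (auto simp: topspace_zariski)
  show ?thesis
  proof
    assume irr: "irreducible_space (subtopology (zariski n) X)"
    have cl: "closedin (subtopology (zariski n) X) {x\<in>X. f x = 0}" if "f \<in> poly_funs n" for f
    proof -
      have "closedin (zariski n) (zero_locus n {f})" using that closedin_zariski by blast
      moreover have "{x\<in>X. f x = 0} = zero_locus n {f} \<inter> X"
        using assms by (auto simp: zero_locus_def)
      ultimately show ?thesis unfolding closedin_subtopology by blast
    qed
    show "integral_on n X" unfolding integral_on_def
    proof (intro conjI ballI impI)
      show "X \<noteq> {}" using irr unfolding irreducible_space_def ts by blast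
      fix f g assume fg: "f \<in> poly_funs n" "g \<in> poly_funs n" "\<forall>x\<in>X. f x * g x = 0"
      then have "X = {x\<in>X. f x = 0} \<union> {x\<in>X. g x = 0}" by auto
      then have "X = {x\<in>X. f x = 0} \<or> X = {x\<in>X. g x = 0}"
        using irr cl[OF fg(1)] cl[OF fg(2)] unfolding irreducible_space_def ts by blast
      then show "(\<forall>x\<in>X. f x = 0) \<or> (\<forall>x\<in>X. g x = 0)" by blast
    qed
  next
    assume int: "integral_on n X"
    show "irreducible_space (subtopology (zariski n) X)"
      unfolding irreducible_space_def ts
    proof (intro conjI allI impI)
      show "X \<noteq> {}" using int by (simp add: integral_on_def)
      fix C D assume "closedin (subtopology (zariski n) X) C" "closedin (subtopology (zariski n) X) D"
        and eq: "X = C \<union> D"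
      then obtain C' D' where *: "closedin (zariski n) C'" "closedin (zariski n) D'"
        "C = C' \<inter> X" "D = D' \<inter> X" unfolding closedin_subtopology by blast
      then have "X \<subseteq> C' \<or> X \<subseteq> D'" using integral_on_subset_Un[OF int *(1,2)] eq by blast
      then show "X = C \<or> X = D" using * by blast
    qed
  qed
qed

text \<open>
  The closure in \<^term>\<open>zariski n\<close>, described by the functions that vanish on \<open>X\<close>; by this
  description, proving that a point lies in a closure means evaluating polynomials.
\<close>

definition zariski_closure :: "nat \<Rightarrow> (nat \<Rightarrow> 'k::idom) set \<Rightarrow> (nat \<Rightarrow> 'k) set" where
  "zariski_closure n X =
     {y \<in> affine_space n. \<forall>f\<in>poly_funs n. (\<forall>x\<in>X. f x = 0) \<longrightarrow> f y = 0}"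

lemma zariski_closure_superset: "X \<subseteq> affine_space n \<Longrightarrow> X \<subseteq> zariski_closure n X"
  by (auto simp: zariski_closure_def)

lemma closedin_zariski_closure: "closedin (zariski n) (zariski_closure n X)"
proof -
  have "zariski_closure n X = zero_locus n {f \<in> poly_funs n. \<forall>x\<in>X. f x = 0}"
    by (simp only: zero_locus_def zariski_closure_def Ball_def mem_Collect_eq imp_conjL)
  then show ?thesis unfolding closedin_zariski by (intro exI conjI) (rule Collect_restrict)
qed

lemma zariski_closure_minimal:
  assumes "X \<subseteq> T" "closedin (zariski n) T" shows "zariski_closure n X \<subseteq> T"
proof -
  obtain P where "P \<subseteq> poly_funs n" "T = zero_locus n P"
    using assms(2) unfolding closedin_zariski by blast
  then show ?thesis using assms(1) unfolding zero_locus_def zariski_closure_def by blast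
qed

lemma integral_on_closure:
  assumes "X \<subseteq> affine_space n" "integral_on n X"
  shows "integral_on n (zariski_closure n X)"
proof -
  have sub: "X \<subseteq> zariski_closure n X"
    using assms(1) by (rule zariski_closure_superset)
  show ?thesis unfolding integral_on_def
  proof (intro conjI ballI impI)
    show "zariski_closure n X \<noteq> {}" using sub assms(2) by (auto simp: integral_on_def)
    fix f g assume fg: "f \<in> poly_funs n" "g \<in> poly_funs n" "\<forall>x\<in>zariski_closure n X. f x * g x = 0"
    then have "(\<forall>x\<in>X. f x = 0) \<or> (\<forall>x\<in>X. g x = 0)" using sub integral_onD[OF assms(2)] by blast
    then show "(\<forall>x\<in>zariski_closure n X. f x = 0) \<or> (\<forall>x\<in>zariski_closure n X. g x = 0)"
      unfolding zariski_closure_def using fg by blast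
  qed
qed

section \<open>Rational curves\<close>

text \<open>
  Over a field of characteristic zero, questions about polynomials in many variables are reduced
  to one variable by restriction to curves whose coordinates are rational functions without
  poles on a parameter set \<open>U\<close>.
\<close>

definition rational_on :: "'k::field set \<Rightarrow> ('k \<Rightarrow> 'k) \<Rightarrow> bool" where
  "rational_on U g \<longleftrightarrow> (\<exists>p q. \<forall>\<tau>\<in>U. poly q \<tau> \<noteq> 0 \<and> g \<tau> = poly p \<tau> / poly q \<tau>)"

lemma rational_on_poly: "rational_on U (poly p)"
  unfolding rational_on_def by (rule exI[of _ p], rule exI[of _ 1]) simp

lemma rational_on_const: "rational_on U (\<lambda>\<tau>. c)"
  using rational_on_poly[of U "[:c:]"] by (simp add: rational_on_def)

lemma rational_on_id: "rational_on U (\<lambda>\<tau>. \<tau>)"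
  using rational_on_poly[of U "[:0, 1:]"] by (simp add: rational_on_def)

lemma rational_on_add:
  assumes "rational_on U f" "rational_on U g"
  shows "rational_on U (\<lambda>\<tau>. f \<tau> + g \<tau>)"
proof -
  obtain p q p' q' where *: "\<forall>\<tau>\<in>U. poly q \<tau> \<noteq> 0 \<and> f \<tau> = poly p \<tau> / poly q \<tau>"
    "\<forall>\<tau>\<in>U. poly q' \<tau> \<noteq> 0 \<and> g \<tau> = poly p' \<tau> / poly q' \<tau>"
    using assms unfolding rational_on_def by blast
  show ?thesis unfolding rational_on_def
    by (rule exI[of _ "p * q' + p' * q"], rule exI[of _ "q * q'"])
      (use * in \<open>auto simp: field_simps\<close>)
qed

lemma rational_on_mult:
  assumes "rational_on U f" "rational_on U g"
  shows "rational_on U (\<lambda>\<tau>. f \<tau> * g \<tau>)"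
proof -
  obtain p q p' q' where *: "\<forall>\<tau>\<in>U. poly q \<tau> \<noteq> 0 \<and> f \<tau> = poly p \<tau> / poly q \<tau>"
    "\<forall>\<tau>\<in>U. poly q' \<tau> \<noteq> 0 \<and> g \<tau> = poly p' \<tau> / poly q' \<tau>"
    using assms unfolding rational_on_def by blast
  show ?thesis unfolding rational_on_def
    by (rule exI[of _ "p * p'"], rule exI[of _ "q * q'"]) (use * in auto)
qed

lemma rational_on_divide:
  assumes "rational_on U f" "rational_on U g" "\<And>\<tau>. \<tau> \<in> U \<Longrightarrow> g \<tau> \<noteq> 0"
  shows "rational_on U (\<lambda>\<tau>. f \<tau> / g \<tau>)"
proof -
  obtain p q p' q' where *: "\<forall>\<tau>\<in>U. poly q \<tau> \<noteq> 0 \<and> f \<tau> = poly p \<tau> / poly q \<tau>"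
    "\<forall>\<tau>\<in>U. poly q' \<tau> \<noteq> 0 \<and> g \<tau> = poly p' \<tau> / poly q' \<tau>"
    using assms unfolding rational_on_def by blast
  show ?thesis unfolding rational_on_def
    by (rule exI[of _ "p * q'"], rule exI[of _ "q * p'"]) (use * assms(3) in auto)
qed

lemma rational_on_power: "rational_on U f \<Longrightarrow> rational_on U (\<lambda>\<tau>. f \<tau> ^ k)"
  by (induction k) (auto intro: rational_on_const rational_on_mult)

lemma rational_on_prod:
  "(\<And>i. i \<in> I \<Longrightarrow> rational_on U (f i)) \<Longrightarrow> rational_on U (\<lambda>\<tau>. \<Prod>i\<in>I. f i \<tau>)"
  by (induction I rule: infinite_finite_induct) (auto intro: rational_on_const rational_on_mult)

lemma rational_on_poly_fun:
  assumes "f \<in> poly_funs n" "\<And>i. i \<in> {1..n} \<Longrightarrow> rational_on U (\<lambda>\<tau>. \<gamma> \<tau> i)"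
  shows "rational_on U (\<lambda>\<tau>. f (\<gamma> \<tau>))"
  using assms by (induction) (auto intro: rational_on_const rational_on_mult rational_on_add)

text \<open>
  Rational functions on an infinite set have no zero divisors, because the product of the
  numerators would have infinitely many roots.
\<close>

lemma rational_on_mult_zero:
  assumes "infinite U" "rational_on U f" "rational_on U g" "\<And>\<tau>. \<tau> \<in> U \<Longrightarrow> f \<tau> * g \<tau> = 0"
  shows "(\<forall>\<tau>\<in>U. f \<tau> = 0) \<or> (\<forall>\<tau>\<in>U. g \<tau> = 0)"
proof -
  obtain p q p' q' where *: "\<forall>\<tau>\<in>U. poly q \<tau> \<noteq> 0 \<and> f \<tau> = poly p \<tau> / poly q \<tau>"
    "\<forall>\<tau>\<in>U. poly q' \<tau> \<noteq> 0 \<and> g \<tau> = poly p' \<tau> / poly q' \<tau>"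
    using assms unfolding rational_on_def by blast
  have "U \<subseteq> {\<tau>. poly (p * p') \<tau> = 0}" using * assms(4) by auto
  then have "p * p' = 0" using poly_roots_finite assms(1) finite_subset by blast
  then show ?thesis using * by auto
qed

text \<open>
  If \<open>f x \<noteq> 0\<close> and \<open>g y \<noteq> 0\<close>, then \<open>f * g\<close> cannot vanish along a rational curve through \<open>x\<close>
  and \<open>y\<close>.  So a set is irreducible as soon as any two of its points lie on a rational curve
  inside it.
\<close>

lemma integral_on_if_curves:
  assumes "X \<noteq> {}"
    and curve: "\<And>x y. x \<in> X \<Longrightarrow> y \<in> X \<Longrightarrow> \<exists>U \<gamma>. infinite U \<and>
      (\<forall>i\<in>{1..n}. rational_on U (\<lambda>\<tau>. \<gamma> \<tau> i)) \<and> (\<forall>\<tau>\<in>U. \<gamma> \<tau> \<in> X) \<and> x \<in> \<gamma> ` U \<and> y \<in> \<gamma> ` U"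
  shows "integral_on n X"
  unfolding integral_on_def
proof (intro conjI ballI impI)
  fix f g assume fg: "f \<in> poly_funs n" "g \<in> poly_funs n" "\<forall>x\<in>X. f x * g x = 0"
  show "(\<forall>x\<in>X. f x = 0) \<or> (\<forall>x\<in>X. g x = 0)"
  proof (rule ccontr)
    assume "\<not> ?thesis"
    then obtain x y where xy: "x \<in> X" "f x \<noteq> 0" "y \<in> X" "g y \<noteq> 0" by blast
    obtain U \<gamma> where U: "infinite U" "\<And>i. i\<in>{1..n} \<Longrightarrow> rational_on U (\<lambda>\<tau>. \<gamma> \<tau> i)"
      "\<forall>\<tau>\<in>U. \<gamma> \<tau> \<in> X" "x \<in> \<gamma> ` U" "y \<in> \<gamma> ` U"
      using curve[OF xy(1,3)] by blast
    have "(\<forall>\<tau>\<in>U. f (\<gamma> \<tau>) = 0) \<or> (\<forall>\<tau>\<in>U. g (\<gamma> \<tau>) = 0)"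
      by (rule rational_on_mult_zero[OF U(1)])
        (use U(3) fg(3) in \<open>auto intro!: rational_on_poly_fun[OF fg(1) U(2)]
          rational_on_poly_fun[OF fg(2) U(2)]\<close>)
    then show False using xy U by auto
  qed
qed (fact assms(1))

text \<open>
  A polynomial that vanishes along the curve for \<open>\<tau> \<noteq> 0\<close> vanishes at \<open>\<tau> = 0\<close> too, so limits of
  curves in \<open>X\<close> belong to the closure of \<open>X\<close>.
\<close>

lemma curve_start_in_closure:
  fixes \<gamma> :: "'k::field_char_0 \<Rightarrow> nat \<Rightarrow> 'k"
  assumes "\<gamma> 0 \<in> affine_space n"
    "\<And>i. i\<in>{1..n} \<Longrightarrow> rational_on UNIV (\<lambda>\<tau>. \<gamma> \<tau> i)"
    "\<And>\<tau>. \<tau> \<noteq> 0 \<Longrightarrow> \<gamma> \<tau> \<in> X"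
  shows "\<gamma> 0 \<in> zariski_closure n X"
  unfolding zariski_closure_def
proof (intro CollectI conjI ballI impI)
  fix f assume f: "f \<in> poly_funs n" "\<forall>x\<in>X. f x = 0"
  have "f (\<gamma> \<tau>) * \<tau> = 0" for \<tau> using f(2) assms(3) by (cases "\<tau> = 0") auto
  then have "(\<forall>\<tau>. f (\<gamma> \<tau>) = 0) \<or> (\<forall>\<tau>::'k. \<tau> = 0)"
    using rational_on_mult_zero[OF infinite_UNIV_char_0
        rational_on_poly_fun[OF f(1), of UNIV \<gamma>, OF assms(2)] rational_on_id] by auto
  then show "f (\<gamma> 0) = 0" using one_neq_zero by blast
qed (fact assms(1))

text \<open>
  On the line from \<open>s\<close> to \<open>t\<close> each coordinate in \<open>S\<close> vanishes at most once, since it is nonzero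
  at \<open>s\<close>.  So the line leaves the torus for finitely many parameters only.
\<close>

lemma infinite_line_avoiding_zeros:
  fixes s t :: "nat \<Rightarrow> 'k::field_char_0"
  assumes "finite S" "\<And>i. i \<in> S \<Longrightarrow> s i \<noteq> 0"
  shows "infinite {\<tau>. \<forall>i\<in>S. s i + \<tau> * (t i - s i) \<noteq> 0}" (is "infinite ?V")
proof
  assume fin: "finite ?V"
  have "finite (\<Union>i\<in>S. {\<tau>. poly [:s i, t i - s i:] \<tau> = 0})"
    using assms by (intro finite_UN_I poly_roots_finite) auto
  with fin have "finite (?V \<union> (\<Union>i\<in>S. {\<tau>. poly [:s i, t i - s i:] \<tau> = 0}))" by (rule finite_UnI)
  moreover have "?V \<union> (\<Union>i\<in>S. {\<tau>. poly [:s i, t i - s i:] \<tau> = 0}) = UNIV"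
    by (simp only: poly_pCons poly_0 mult_zero_right add_0_right) blast
  ultimately show False using infinite_UNIV_char_0[where 'a = 'k] by metis
qed

section \<open>Chains of irreducible closed sets have bounded length\<close>

interpretation fun_space: vector_space "\<lambda>(c::'k::field) f (x::'b). c * f x"
  by unfold_locales (auto simp: fun_eq_iff algebra_simps)

text \<open>
  The bound \<open>d\<close> is on each exponent separately, so that the exponents form a cube with
  \<open>(d + 1) ^ n\<close> points.
\<close>

definition bounded_monomials :: "nat \<Rightarrow> nat \<Rightarrow> ((nat \<Rightarrow> 'k::field) \<Rightarrow> 'k) set" where
  "bounded_monomials n d = (\<lambda>e x. \<Prod>i\<in>{1..n}. x i ^ e i) ` ({1..n} \<rightarrow>\<^sub>E {..d})"

lemma finite_bounded_monomials: "finite (bounded_monomials n d)"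
  unfolding bounded_monomials_def by (intro finite_imageI finite_PiE) auto

lemma card_bounded_monomials: "card (bounded_monomials n d) \<le> (d + 1) ^ n"
proof -
  have "card (bounded_monomials n d) \<le> card ({1..n} \<rightarrow>\<^sub>E {..d})"
    unfolding bounded_monomials_def by (intro card_image_le finite_PiE) auto
  also have "\<dots> = (d + 1) ^ n" by (subst card_funcsetE) auto
  finally show ?thesis .
qed

definition degree_le :: "nat \<Rightarrow> nat \<Rightarrow> ((nat \<Rightarrow> 'k::field) \<Rightarrow> 'k) \<Rightarrow> bool" where
  "degree_le n d f \<longleftrightarrow> f \<in> fun_space.span (bounded_monomials n d)"

lemma degree_le_add: "degree_le n d f \<Longrightarrow> degree_le n d g \<Longrightarrow> degree_le n d (\<lambda>x. f x + g x)"
  unfolding degree_le_def using fun_space.span_add[of f _ g] by (simp add: plus_fun_def)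

lemma degree_le_mono:
  assumes "degree_le n d f" "d \<le> d'" shows "degree_le n d' f"
proof -
  have "bounded_monomials n d \<subseteq> bounded_monomials n d'"
    unfolding bounded_monomials_def using assms(2) by (intro image_mono PiE_mono) auto
  then show ?thesis using assms(1) fun_space.span_mono unfolding degree_le_def by blast
qed

text \<open>
  The product is bilinear, so it is enough to multiply monomials; the spans are reached one
  factor at a time.
\<close>

lemma degree_le_mult:
  assumes f: "degree_le n d f" and g: "degree_le n d' g"
  shows "degree_le n (d + d') (\<lambda>x. f x * g x)"
proof -
  let ?S = "fun_space.span (bounded_monomials n (d + d'))"
  have sub1: "fun_space.subspace {f. (\<lambda>x. f x * g x) \<in> ?S}" for g
  proof (rule fun_space.subspaceI)
    fix u v assume "u \<in> {f. (\<lambda>x. f x * g x) \<in> ?S}" "v \<in> {f. (\<lambda>x. f x * g x) \<in> ?S}"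
    then show "u + v \<in> {f. (\<lambda>x. f x * g x) \<in> ?S}"
      using fun_space.span_add[of "\<lambda>x. u x * g x" _ "\<lambda>x. v x * g x"]
      by (simp add: plus_fun_def algebra_simps)
  next
    fix c u assume "u \<in> {f. (\<lambda>x. f x * g x) \<in> ?S}"
    then show "(\<lambda>x. c * u x) \<in> {f. (\<lambda>x. f x * g x) \<in> ?S}"
      using fun_space.span_scale[of "\<lambda>x. u x * g x" _ c] by (simp add: algebra_simps)
  qed (use fun_space.span_zero in \<open>simp add: zero_fun_def\<close>)
  have base: "(\<lambda>x. u x * v x) \<in> ?S" if "u \<in> bounded_monomials n d" "v \<in> bounded_monomials n d'" for u v
  proof -
    obtain e e' where e: "e \<in> {1..n} \<rightarrow>\<^sub>E {..d}" "e' \<in> {1..n} \<rightarrow>\<^sub>E {..d'}"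
      "u = (\<lambda>x. \<Prod>i\<in>{1..n}. x i ^ e i)" "v = (\<lambda>x. \<Prod>i\<in>{1..n}. x i ^ e' i)"
      using \<open>u \<in> _\<close> \<open>v \<in> _\<close> unfolding bounded_monomials_def by blast
    have "(\<lambda>i\<in>{1..n}. e i + e' i) \<in> {1..n} \<rightarrow>\<^sub>E {..d + d'}"
      using e(1,2) by (auto intro!: add_mono)
    moreover have "(\<lambda>x. u x * v x) = (\<lambda>x. \<Prod>i\<in>{1..n}. x i ^ (\<lambda>i\<in>{1..n}. e i + e' i) i)"
      unfolding e prod.distrib[symmetric] by (intro ext prod.cong) (auto simp: power_add)
    ultimately have "(\<lambda>x. u x * v x) \<in> bounded_monomials n (d + d')"
      unfolding bounded_monomials_def by blast
    then show ?thesis by (rule fun_space.span_base)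
  qed
  have "(\<lambda>x. f x * v x) \<in> ?S" if "v \<in> bounded_monomials n d'" for v
    using fun_space.span_minimal[OF _ sub1[of v], of "bounded_monomials n d"] base that f
    unfolding degree_le_def by blast
  then have "bounded_monomials n d' \<subseteq> {g. (\<lambda>x. g x * f x) \<in> ?S}" by (auto simp: mult.commute)
  from fun_space.span_minimal[OF this sub1] g show ?thesis
    unfolding degree_le_def by (auto simp: mult.commute)
qed

lemma degree_le_const: "degree_le n d (\<lambda>x. c)"
proof -
  have "(\<lambda>i\<in>{1..n}. 0) \<in> {1..n} \<rightarrow>\<^sub>E {..d}" by auto
  then have "(\<lambda>x. \<Prod>i\<in>{1..n}. x i ^ (\<lambda>i\<in>{1..n}. 0) i) \<in> bounded_monomials n d"
    unfolding bounded_monomials_def by blast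
  then have "(\<lambda>x. 1) \<in> bounded_monomials n d" by simp
  from fun_space.span_scale[OF fun_space.span_base[OF this], of c]
  show ?thesis by (simp add: degree_le_def)
qed

lemma degree_le_coord:
  fixes i :: nat
  assumes "i \<in> {1..n}" shows "degree_le n 1 (\<lambda>x :: nat \<Rightarrow> 'k::field. x i)"
proof -
  define e where "e = (\<lambda>j\<in>{1..n}. if j = i then 1 else 0 :: nat)"
  have "(\<Prod>j\<in>{1..n}. x j ^ e j) = x i" for x :: "nat \<Rightarrow> 'k"
  proof -
    have "(\<Prod>j\<in>{1..n}. x j ^ e j) = (\<Prod>j\<in>{1..n}. if j = i then x j else 1)"
      by (rule prod.cong) (auto simp: e_def)
    also have "\<dots> = x i" using assms by (subst prod.delta) auto
    finally show ?thesis .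
  qed
  then have "(\<lambda>x :: nat \<Rightarrow> 'k. x i) = (\<lambda>x. \<Prod>j\<in>{1..n}. x j ^ e j)" by simp
  moreover have "e \<in> {1..n} \<rightarrow>\<^sub>E {..1}" by (auto simp: e_def)
  ultimately have "(\<lambda>x :: nat \<Rightarrow> 'k. x i) \<in> bounded_monomials n 1"
    unfolding bounded_monomials_def by blast
  then show ?thesis unfolding degree_le_def by (rule fun_space.span_base)
qed

lemma poly_fun_degree_le: "f \<in> poly_funs n \<Longrightarrow> \<exists>d. degree_le n d f"
proof (induction rule: poly_funs.induct)
  case (add f g)
  then obtain d d' where "degree_le n d f" "degree_le n d' g" by blast
  then have "degree_le n (max d d') (\<lambda>x. f x + g x)"
    by (intro degree_le_add) (auto elim: degree_le_mono)
  then show ?case by blast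
qed (blast intro: degree_le_const degree_le_coord degree_le_mult)+

lemma degree_le_power: "degree_le n d f \<Longrightarrow> degree_le n (k * d) (\<lambda>x. f x ^ k)"
  by (induction k) (auto intro: degree_le_const degree_le_mult)

lemma degree_le_prod:
  "finite I \<Longrightarrow> (\<And>i. i \<in> I \<Longrightarrow> degree_le n d (f i)) \<Longrightarrow> degree_le n (card I * d) (\<lambda>x. \<Prod>i\<in>I. f i x)"
  by (induction I rule: finite_induct) (auto intro: degree_le_const degree_le_mult)

text \<open>
  A strict chain of irreducible closed sets yields algebraically independent functions: \<open>h i\<close> is
  to vanish on \<open>C i\<close> but not on \<open>C (Suc i)\<close>.  A polynomial relation among \<open>h 0, \<dots>, h k\<close> on
  \<open>C (Suc k)\<close> is expanded in powers of \<open>h k\<close>.  On \<open>C k\<close> only the constant term survives, which is a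
  relation among \<open>h 0, \<dots>, h (k - 1)\<close> there, hence trivial by induction.  The rest of the relation
  is divisible by \<open>h k\<close>, which can be cancelled because \<open>C (Suc k)\<close> is irreducible.  The
  independence is stated for exponents below an arbitrary bound \<open>N\<close>, as a finite sum.
\<close>

lemma chain_separators_independent:
  fixes C :: "nat \<Rightarrow> (nat \<Rightarrow> 'k::field) set"
  assumes "\<And>i. i < k \<Longrightarrow> h i \<in> poly_funs n"
    and "\<And>i. i \<le> k \<Longrightarrow> integral_on n (C i)"
    and "\<And>i. i < k \<Longrightarrow> C i \<subseteq> C (Suc i)"
    and "\<And>i x. i < k \<Longrightarrow> x \<in> C i \<Longrightarrow> h i x = 0"
    and "\<And>i. i < k \<Longrightarrow> \<exists>x\<in>C (Suc i). h i x \<noteq> 0"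
    and "\<And>x. x \<in> C k \<Longrightarrow> (\<Sum>e\<in>{..<k} \<rightarrow>\<^sub>E {..<N}. c e * (\<Prod>i<k. h i x ^ e i)) = 0"
    and "e \<in> {..<k} \<rightarrow>\<^sub>E {..<N}"
  shows "c e = 0"
  using assms
proof (induction k arbitrary: c e)
  case 0
  then show ?case by (auto simp: integral_on_def)
next
  case (Suc k)
  define E where "E = ({..<k} \<rightarrow>\<^sub>E {..<N} :: (nat \<Rightarrow> nat) set)"
  define p where "p j x = (\<Sum>e\<in>E. c (e(k := j)) * (\<Prod>i<k. h i x ^ e i))" for j x
  have p_poly: "p j \<in> poly_funs n" for j
    unfolding p_def
    by (intro poly_funs_sum poly_funs.mult poly_funs.const poly_funs_prod poly_funs_power Suc.prems(1)) auto
  have h_poly: "h k \<in> poly_funs n" using Suc.prems(1) by simp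
  have split: "(\<Sum>e\<in>{..<Suc k} \<rightarrow>\<^sub>E {..<N}. c e * (\<Prod>i<Suc k. h i x ^ e i)) = (\<Sum>j<N. p j x * h k x ^ j)" for x
  proof -
    have "(\<Sum>e\<in>{..<Suc k} \<rightarrow>\<^sub>E {..<N}. c e * (\<Prod>i<Suc k. h i x ^ e i)) =
       (\<Sum>(j, e)\<in>{..<N} \<times> E. c (e(k := j)) * (\<Prod>i<Suc k. h i x ^ (e(k := j)) i))"
      unfolding E_def lessThan_Suc PiE_insert_eq
      by (subst sum.reindex[OF inj_combinator]) (auto simp: case_prod_unfold)
    also have "\<dots> = (\<Sum>j<N. \<Sum>e\<in>E. c (e(k := j)) * (\<Prod>i<Suc k. h i x ^ (e(k := j)) i))"
      by (rule sum.cartesian_product[symmetric])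
    also have "\<dots> = (\<Sum>j<N. p j x * h k x ^ j)"
    proof (intro sum.cong refl)
      fix j
      have "(\<Prod>i<k. h i x ^ (e(k := j)) i) = (\<Prod>i<k. h i x ^ e i)" for e
        by (rule prod.cong) auto
      then show "(\<Sum>e\<in>E. c (e(k := j)) * (\<Prod>i<Suc k. h i x ^ (e(k := j)) i)) = p j x * h k x ^ j"
        unfolding p_def sum_distrib_right by (intro sum.cong) (auto simp: mult_ac)
    qed
    finally show ?thesis .
  qed
  have coeff0: "c (e(k := j)) = 0" if "\<And>x. x \<in> C k \<Longrightarrow> p j x = 0" "e \<in> E" for j e
  proof (rule Suc.IH[of "\<lambda>e. c (e(k := j))"])
    show "e \<in> {..<k} \<rightarrow>\<^sub>E {..<N}" using that(2) by (simp add: E_def)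
    show "(\<Sum>e\<in>{..<k} \<rightarrow>\<^sub>E {..<N}. c (e(k := j)) * (\<Prod>i<k. h i x ^ e i)) = 0" if "x \<in> C k" for x
      using \<open>\<And>x. x \<in> C k \<Longrightarrow> p j x = 0\<close>[OF that] by (simp add: p_def E_def)
  qed (use Suc.prems in auto)
  \<comment> \<open>Lowest powers of \<open>h k\<close> first: cancel \<open>h k ^ j\<close> on \<open>C (Suc k)\<close>, then restrict to \<open>C k\<close>,
      where \<open>h k\<close> is zero and only \<open>p j\<close> is left.\<close>
  have all0: "j < N \<longrightarrow> (\<forall>e\<in>E. c (e(k := j)) = 0)" for j
  proof (induction j rule: less_induct)
    case (less j)
    show ?case
    proof
      assume j: "j < N"
      have p0: "p i x = 0" if "i < j" for i x
        using less[of i] that j unfolding p_def by (auto intro!: sum.neutral simp del: fun_upd_apply)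
      define r where "r x = (\<Sum>i\<in>{j..<N}. p i x * h k x ^ (i - j))" for x
      have r_poly: "r \<in> poly_funs n"
        unfolding r_def by (intro poly_funs_sum poly_funs.mult p_poly poly_funs_power h_poly)
      have fac: "(\<Sum>i<N. p i x * h k x ^ i) = h k x ^ j * r x" for x
      proof -
        have "(\<Sum>i<N. p i x * h k x ^ i) = (\<Sum>i\<in>{j..<N}. p i x * h k x ^ i)"
          by (rule sum.mono_neutral_right) (auto simp: p0 not_le)
        also have "\<dots> = h k x ^ j * r x" unfolding r_def sum_distrib_left
          by (intro sum.cong) (auto simp: mult_ac simp flip: power_add)
        finally show ?thesis .
      qed
      have "(\<forall>x\<in>C (Suc k). h k x ^ j = 0) \<or> (\<forall>x\<in>C (Suc k). r x = 0)"
      proof (rule integral_onD)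
        show "integral_on n (C (Suc k))" using Suc.prems(2) by simp
        show "h k x ^ j * r x = 0" if "x \<in> C (Suc k)" for x
          using Suc.prems(6)[OF that] split fac by simp
      qed (intro poly_funs_power h_poly r_poly)+
      then have r0: "\<forall>x\<in>C (Suc k). r x = 0" using Suc.prems(5)[of k] by auto
      have "p j x = 0" if x: "x \<in> C k" for x
      proof -
        have "h k x = 0" using Suc.prems(4) x by simp
        then have "r x = (\<Sum>i\<in>{j..<N}. if i = j then p i x else 0)"
          unfolding r_def by (intro sum.cong) auto
        also have "\<dots> = p j x" using j by simp
        finally show ?thesis using r0 x Suc.prems(3)[of k] by auto
      qed
      then show "\<forall>e\<in>E. c (e(k := j)) = 0" using coeff0 by blast
    qed
  qed
  have "e \<in> (\<lambda>(y, g). g(k := y)) ` ({..<N} \<times> E)"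
    using Suc.prems(7) unfolding E_def lessThan_Suc PiE_insert_eq .
  then show ?case using all0 by auto
qed

text \<open>
  Affine \<open>n\<close>-space has dimension at most \<open>n\<close>, by counting.  If a chain had length \<open>k > n\<close>, the
  separating functions would give \<open>N ^ k\<close> linearly independent products with exponents below \<open>N\<close>;
  these lie in a space of polynomials of degree \<open>O(N)\<close>, whose dimension is \<open>O(N ^ n)\<close>.  For large
  \<open>N\<close> this is impossible.
\<close>

lemma chain_length_le:
  fixes C :: "nat \<Rightarrow> (nat \<Rightarrow> 'k::field) set"
  assumes cl: "\<And>i. i \<le> k \<Longrightarrow> closedin (zariski n) (C i)"
    and int: "\<And>i. i \<le> k \<Longrightarrow> integral_on n (C i)"
    and less: "\<And>i. i < k \<Longrightarrow> C i \<subset> C (Suc i)"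
  shows "k \<le> n"
proof (rule ccontr)
  assume "\<not> k \<le> n"
  have "\<exists>h. h \<in> poly_funs n \<and> (\<forall>x\<in>C i. h x = 0) \<and> (\<exists>x\<in>C (Suc i). h x \<noteq> 0)" if i: "i < k" for i
  proof -
    obtain P where P: "P \<subseteq> poly_funs n" "C i = zero_locus n P"
      using cl[of i] i unfolding closedin_zariski by auto
    obtain x where x: "x \<in> C (Suc i)" "x \<notin> C i" using less[OF i] by blast
    have "x \<in> affine_space n"
      using x(1) cl[of "Suc i"] i closedin_subset[of "zariski n" "C (Suc i)"] by (auto simp: topspace_zariski)
    then show ?thesis using P x by (auto simp: zero_locus_def)
  qed
  then obtain h where h: "\<And>i. i < k \<Longrightarrow> h i \<in> poly_funs n"
    "\<And>i x. i < k \<Longrightarrow> x \<in> C i \<Longrightarrow> h i x = 0" "\<And>i. i < k \<Longrightarrow> \<exists>x\<in>C (Suc i). h i x \<noteq> 0"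
    by metis
  obtain D where D: "\<And>i. i < k \<Longrightarrow> degree_le n (D i) (h i)"
    using poly_fun_degree_le[OF h(1)] by metis
  define d where "d = (\<Sum>i<k. D i)"
  have d: "degree_le n d (h i)" if "i < k" for i
    by (rule degree_le_mono[OF D[OF that]])
      (use that in \<open>auto simp: d_def intro!: member_le_sum\<close>)
  \<comment> \<open>This \<open>N\<close> makes \<open>N ^ k\<close> exceed the number of monomials, which is at most \<open>(k * d + 1) ^ n * N ^ n\<close>.\<close>
  define N where "N = (k * d + 1) ^ n + 1"
  define E where "E = ({..<k} \<rightarrow>\<^sub>E {..<N} :: (nat \<Rightarrow> nat) set)"
  define F where "F e x = (\<Prod>i<k. h i x ^ e i)" for e x
  have finE: "finite E" unfolding E_def by (intro finite_PiE) auto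
  have indep: "c e = 0" if "(\<Sum>e\<in>E. (\<lambda>x. c e * F e x)) = 0" "e \<in> E" for c e
  proof (rule chain_separators_independent[where k = k and h = h and n = n and C = C and N = N and c = c])
    show "e \<in> {..<k} \<rightarrow>\<^sub>E {..<N}" using that(2) by (simp add: E_def)
    have "(\<Sum>e\<in>E. (\<lambda>x. c e * F e x)) x = (\<Sum>e\<in>E. c e * F e x)" for x
      by (induction E rule: infinite_finite_induct) auto
    then show "(\<Sum>e\<in>{..<k} \<rightarrow>\<^sub>E {..<N}. c e * (\<Prod>i<k. h i x ^ e i)) = 0" for x
      using that(1) by (simp add: E_def F_def)
  next
    show "C i \<subseteq> C (Suc i)" if "i < k" for i using less[OF that] by blast
  qed (fact h int)+
  have inj: "inj_on F E"
  proof (rule inj_onI, rule ccontr)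
    fix e e' assume e: "e \<in> E" "e' \<in> E" "F e = F e'" "e \<noteq> e'"
    let ?c = "\<lambda>u. if u = e then 1 else if u = e' then -1 else 0 :: 'k"
    have "(\<Sum>u\<in>E. (\<lambda>x. ?c u * F u x)) = (\<Sum>u\<in>{e, e'}. (\<lambda>x. ?c u * F u x))"
      using e finE by (intro sum.mono_neutral_right) (auto simp: fun_eq_iff)
    also have "\<dots> = 0" using e by (auto simp: fun_eq_iff)
    finally have "?c e = 0" using indep[of ?c e] e(1) by blast
    then show False by simp
  qed
  have "\<not> fun_space.dependent (F ` E)"
  proof
    assume "fun_space.dependent (F ` E)"
    then have "\<exists>c. (\<exists>f\<in>F ` E. c f \<noteq> 0) \<and> (\<Sum>f\<in>F ` E. (\<lambda>x. c f * f x)) = 0"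
      by (simp only: fun_space.dependent_finite[OF finite_imageI[OF finE]])
    then obtain c where c: "\<exists>f\<in>F ` E. c f \<noteq> 0" "(\<Sum>f\<in>F ` E. (\<lambda>x. c f * f x)) = 0"
      by (elim exE conjE)
    then obtain e where e: "e \<in> E" "c (F e) \<noteq> 0" by blast
    have "(\<Sum>e\<in>E. (\<lambda>x. c (F e) * F e x)) = 0"
      using c(2) unfolding sum.reindex[OF inj] comp_def .
    then have "c (F e) = 0" using e(1) by (rule indep[where c = "\<lambda>e. c (F e)"])
    then show False using e(2) by contradiction
  qed
  moreover have "F ` E \<subseteq> fun_space.span (bounded_monomials n (k * (N * d)))"
  proof
    fix f assume "f \<in> F ` E"
    then obtain e where e: "e \<in> E" "f = F e" by blast
    have "degree_le n (card {..<k} * (N * d)) (\<lambda>x. \<Prod>i\<in>{..<k}. h i x ^ e i)"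
    proof (rule degree_le_prod)
      fix i assume i: "i \<in> {..<k}"
      then have "e i \<le> N" using e(1) unfolding E_def by (force dest: PiE_mem)
      moreover have "degree_le n (e i * d) (\<lambda>x. h i x ^ e i)" using d i by (intro degree_le_power) auto
      ultimately show "degree_le n (N * d) (\<lambda>x. h i x ^ e i)"
        by (meson degree_le_mono mult_le_mono1)
    qed simp
    then show "f \<in> fun_space.span (bounded_monomials n (k * (N * d)))"
      by (simp add: e(2) F_def[abs_def] degree_le_def)
  qed
  ultimately have "card (F ` E) \<le> card (bounded_monomials n (k * (N * d)) :: ((nat \<Rightarrow> 'k) \<Rightarrow> 'k) set)"
    using fun_space.independent_span_bound[OF finite_bounded_monomials] by blast
  also have "\<dots> \<le> (k * (N * d) + 1) ^ n" by (rule card_bounded_monomials)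
  also have "\<dots> \<le> ((k * d + 1) * N) ^ n"
    by (rule power_mono) (auto simp: N_def algebra_simps)
  also have "\<dots> = (k * d + 1) ^ n * N ^ n" by (rule power_mult_distrib)
  also have "\<dots> < N * N ^ n" by (simp add: N_def)
  also have "\<dots> = N ^ (n + 1)" by simp
  also have "\<dots> \<le> N ^ k" using \<open>\<not> k \<le> n\<close> by (intro power_increasing) (auto simp: N_def)
  also have "\<dots> = card (F ` E)"
    unfolding card_image[OF inj] by (simp add: E_def card_funcsetE)
  finally show False by simp
qed

section \<open>Images of tori\<close>

lemma monomial_eq_0_iff:
  "monomial n a (x :: nat \<Rightarrow> 'k::idom) = 0 \<longleftrightarrow> (\<exists>i\<in>{1..<n}. x i = 0 \<and> a i > 0)"
  by (auto simp: monomial_def)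

lemma two_power_eq_iff: "(2::'k::field_char_0) ^ p = 2 ^ q \<longleftrightarrow> p = q"
proof -
  have "(2::'k) ^ p = 2 ^ q \<longleftrightarrow> of_nat (2 ^ p) = (of_nat (2 ^ q) :: 'k)" by simp
  also have "\<dots> \<longleftrightarrow> p = q" unfolding of_nat_eq_iff by simp
  finally show ?thesis .
qed

text \<open>
  Coordinates outside \<open>S\<close> are fixed to \<open>1\<close> rather than left out: the partial tori then form an
  increasing family of subsets of one torus, and all of them share one parametrization.
\<close>

definition partial_torus :: "nat set \<Rightarrow> (nat \<Rightarrow> 'k::field) set" where
  "partial_torus S = {t. (\<forall>i. t i \<noteq> 0) \<and> (\<forall>i. i \<notin> S \<longrightarrow> t i = 1)}"

text \<open>
  If \<open>a i0 = b i0 + e\<close> and \<open>c ^ e = 1\<close>, this parametrizes solutions of \<open>x\<^sup>a = x\<^sup>b\<close> by the torus in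
  the coordinates other than \<open>i0\<close>: with \<open>x i = t i ^ e\<close> and after cancelling \<open>x i0 ^ b i0\<close>,
  the equation becomes \<open>x i0 ^ e * (t\<^sup>a) ^ e = (t\<^sup>b) ^ e\<close>, the \<open>e\<close>-th power of an equation that
  can be solved for \<open>x i0\<close>.
  Parameters have \<open>t i0 = 1\<close>, so that \<open>t\<^sup>a\<close> and \<open>t\<^sup>b\<close> omit the index \<open>i0\<close>.  The case \<open>c = 0\<close>,
  \<open>e = 1\<close> parametrizes the points of the subspace \<open>x i0 = x n = 0\<close> whose other coordinates are
  nonzero.
\<close>

definition toric_point ::
  "nat \<Rightarrow> (nat \<Rightarrow> nat) \<Rightarrow> (nat \<Rightarrow> nat) \<Rightarrow> nat \<Rightarrow> nat \<Rightarrow> 'k::field \<Rightarrow> (nat \<Rightarrow> 'k) \<Rightarrow> nat \<Rightarrow> 'k" where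
  "toric_point n a b i0 e c t = (\<lambda>i\<in>{1..n}. if i = n then 0
     else if i = i0 then c * monomial n b t / monomial n a t else t i ^ e)"

definition toric_set ::
  "nat \<Rightarrow> (nat \<Rightarrow> nat) \<Rightarrow> (nat \<Rightarrow> nat) \<Rightarrow> nat \<Rightarrow> nat \<Rightarrow> 'k::field \<Rightarrow> nat set \<Rightarrow> (nat \<Rightarrow> 'k) set" where
  "toric_set n a b i0 e c S = toric_point n a b i0 e c ` partial_torus S"

lemma toric_set_subset_affine: "toric_set n a b i0 e c S \<subseteq> affine_space n"
  by (auto simp: toric_set_def toric_point_def affine_space_def)

lemma monomial_partial_torus_nonzero: "t \<in> partial_torus S \<Longrightarrow> monomial n a t \<noteq> 0"
  by (auto simp: monomial_eq_0_iff partial_torus_def)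

text \<open>
  Two parameters are joined by a line, which stays in the torus up to finitely many points; its
  image is a rational curve.
\<close>

lemma integral_on_toric_set:
  fixes c :: "'k::field_char_0"
  assumes "finite S"
  shows "integral_on n (toric_set n a b i0 e c S)"
proof (rule integral_on_if_curves)
  have "(\<lambda>_. 1) \<in> partial_torus S" by (simp add: partial_torus_def)
  then show "toric_set n a b i0 e c S \<noteq> {}" unfolding toric_set_def by blast
  fix x y assume "x \<in> toric_set n a b i0 e c S" "y \<in> toric_set n a b i0 e c S"
  then obtain s t where st: "s \<in> partial_torus S" "t \<in> partial_torus S"
    "x = toric_point n a b i0 e c s" "y = toric_point n a b i0 e c t"
    unfolding toric_set_def by blast
  define U where "U = {\<tau>. \<forall>i\<in>S. s i + \<tau> * (t i - s i) \<noteq> 0}"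
  define l where "l \<tau> i = s i + \<tau> * (t i - s i)" for \<tau> i
  have l: "l \<tau> \<in> partial_torus S" if "\<tau> \<in> U" for \<tau>
  proof -
    have one: "l \<tau> i = 1" if "i \<notin> S" for i using st that by (simp add: l_def partial_torus_def)
    have "l \<tau> i \<noteq> 0" for i
      using \<open>\<tau> \<in> U\<close> one by (cases "i \<in> S") (simp_all add: l_def U_def)
    then show ?thesis using one by (simp add: partial_torus_def)
  qed
  have U: "infinite U" unfolding U_def
    using assms st(1) by (intro infinite_line_avoiding_zeros) (auto simp: partial_torus_def)
  have ends: "0 \<in> U" "1 \<in> U" "l 0 = s" "l 1 = t"
    using st by (auto simp: U_def l_def partial_torus_def)
  have rl: "rational_on U (\<lambda>\<tau>. l \<tau> i)" for i
    unfolding l_def by (intro rational_on_add rational_on_mult rational_on_const rational_on_id)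
  have rm: "rational_on U (\<lambda>\<tau>. monomial n d (l \<tau>))" for d
    unfolding monomial_def by (intro rational_on_prod rational_on_power rl)
  have "rational_on U (\<lambda>\<tau>. toric_point n a b i0 e c (l \<tau>) i)" if "i \<in> {1..n}" for i
  proof -
    have "rational_on U (\<lambda>\<tau>. c * monomial n b (l \<tau>) / monomial n a (l \<tau>))"
      using l monomial_partial_torus_nonzero
      by (intro rational_on_divide rational_on_mult rational_on_const rm) blast
    then show ?thesis using that rational_on_power[OF rl, of i e] rational_on_const[of U 0]
      by (cases "i = n"; cases "i = i0") (simp_all add: toric_point_def)
  qed
  moreover have "toric_point n a b i0 e c (l \<tau>) \<in> toric_set n a b i0 e c S" if "\<tau> \<in> U" for \<tau>
    using l[OF that] by (simp add: toric_set_def)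
  moreover have "x \<in> (\<lambda>\<tau>. toric_point n a b i0 e c (l \<tau>)) ` U"
    by (rule image_eqI[of _ _ 0]) (use ends st in simp_all)
  moreover have "y \<in> (\<lambda>\<tau>. toric_point n a b i0 e c (l \<tau>)) ` U"
    by (rule image_eqI[of _ _ 1]) (use ends st in simp_all)
  ultimately show "\<exists>U \<gamma>. infinite U \<and> (\<forall>i\<in>{1..n}. rational_on U (\<lambda>\<tau>. \<gamma> \<tau> i)) \<and>
      (\<forall>\<tau>\<in>U. \<gamma> \<tau> \<in> toric_set n a b i0 e c S) \<and> x \<in> \<gamma> ` U \<and> y \<in> \<gamma> ` U"
    using U by (intro exI[of _ U] exI[of _ "\<lambda>\<tau>. toric_point n a b i0 e c (l \<tau>)"]) blast
qed

text \<open>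
  Freeing a coordinate \<open>i\<close> of the torus enlarges the closure: the function \<open>x i - 1\<close> vanishes on the
  smaller set, while \<open>t i = 2\<close> gives \<open>x i = 2 ^ e \<noteq> 1\<close> on the larger one.
\<close>

lemma toric_closure_strict_mono:
  fixes c :: "'k::field_char_0"
  assumes "S \<subset> S'" "S' \<subseteq> {1..<n} - {i0}" "e > 0"
  shows "zariski_closure n (toric_set n a b i0 e c S) \<subset> zariski_closure n (toric_set n a b i0 e c S')"
proof -
  have sub: "toric_set n a b i0 e c S \<subseteq> toric_set n a b i0 e c S'"
    using assms(1) unfolding toric_set_def by (intro image_mono) (auto simp: partial_torus_def)
  obtain i where i: "i \<in> S'" "i \<notin> S" using assms(1) by blast
  then have i': "i \<in> {1..<n}" "i \<noteq> i0" using assms(2) by auto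
  define t where "t = (\<lambda>j. if j = i then 2 else 1 :: 'k)"
  have t: "t \<in> partial_torus S'" using i by (auto simp: t_def partial_torus_def)
  then have in': "toric_point n a b i0 e c t \<in> zariski_closure n (toric_set n a b i0 e c S')"
    using zariski_closure_superset[OF toric_set_subset_affine] unfolding toric_set_def by blast
  define f where "f = (\<lambda>x :: nat \<Rightarrow> 'k. x i + (-1))"
  have f: "f \<in> poly_funs n" unfolding f_def
    using i' by (intro poly_funs.add poly_funs.coord poly_funs.const) auto
  have f0: "\<forall>x\<in>toric_set n a b i0 e c S. f x = 0"
    using i i' by (auto simp: toric_set_def toric_point_def partial_torus_def f_def)
  have "f (toric_point n a b i0 e c t) = 2 ^ e - 1"
    using i' by (simp add: toric_point_def f_def t_def)
  moreover have "(2::'k) ^ e \<noteq> 2 ^ 0" unfolding two_power_eq_iff using assms(3) by simp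
  ultimately have "f (toric_point n a b i0 e c t) \<noteq> 0" by simp
  then have "toric_point n a b i0 e c t \<notin> zariski_closure n (toric_set n a b i0 e c S)"
    using f f0 unfolding zariski_closure_def by blast
  moreover have "zariski_closure n (toric_set n a b i0 e c S) \<subseteq> zariski_closure n (toric_set n a b i0 e c S')"
    using sub zariski_closure_superset[OF toric_set_subset_affine]
    by (intro zariski_closure_minimal closedin_zariski_closure) blast
  ultimately show ?thesis using in' by blast
qed

lemma le_krull_dimI:
  fixes C :: "(nat \<Rightarrow> 'k::field) set"
  assumes "\<And>i. i \<le> k \<Longrightarrow> closedin (zariski n) (D i)" "\<And>i. i \<le> k \<Longrightarrow> integral_on n (D i)"
    "\<And>i. i < k \<Longrightarrow> D i \<subset> D (Suc i)" "D k \<subseteq> C"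
  shows "enat k \<le> krull_dim (subtopology (zariski n) C)"
  unfolding krull_dim_def
proof (rule Sup_upper, intro CollectI exI conjI refl allI impI)
  have sub: "D i \<subseteq> C" if "i \<le> k" for i
    using that
  proof (induction rule: inc_induct)
    case base then show ?case by (fact assms(4))
  next
    case (step m) then show ?case using assms(3)[of m] by auto
  qed
  fix i assume i: "i \<le> k"
  show "closedin (subtopology (zariski n) C) (D i)"
    unfolding closedin_subtopology using assms(1)[OF i] sub[OF i] by blast
  have "D i \<subseteq> affine_space n" using closedin_subset[OF assms(1)[OF i]] by (simp add: topspace_zariski)
  moreover have "C \<inter> D i = D i" using sub[OF i] by blast
  ultimately show "irreducible_space (subtopology (subtopology (zariski n) C) (D i))"
    using assms(2)[OF i] by (simp add: subtopology_subtopology irreducible_space_zariski_iff)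
next
  fix i assume "i < k" then show "D i \<subset> D (Suc i)" by (rule assms(3))
qed simp

text \<open>
  The \<open>n - 2\<close> free coordinates of the torus are released one after the other.
\<close>

lemma krull_dim_toric_closure_ge:
  fixes c :: "'k::field_char_0"
  assumes "i0 \<in> {1..<n}" "e > 0"
  shows "enat (n - 2) \<le> krull_dim (subtopology (zariski n)
    (zariski_closure n (toric_set n a b i0 e c ({1..<n} - {i0}))))"
proof -
  have "card ({1..<n} - {i0}) = n - 2" using assms(1) by simp
  then obtain g where g: "bij_betw g {0..<n - 2} ({1..<n} - {i0})"
    using ex_bij_betw_nat_finite[of "{1..<n} - {i0}"] by auto
  define S where "S k = g ` {0..<k}" for k
  have S: "S k \<subseteq> {1..<n} - {i0}" if "k \<le> n - 2" for k
    using g that unfolding S_def bij_betw_def by fastforce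
  have strict: "S k \<subset> S (Suc k)" if "k < n - 2" for k
  proof -
    have "g k \<notin> S k"
      using g that unfolding S_def bij_betw_def inj_on_def by fastforce
    then show ?thesis unfolding S_def by auto
  qed
  show ?thesis
  proof (rule le_krull_dimI)
    show "closedin (zariski n) (zariski_closure n (toric_set n a b i0 e c (S k)))" for k
      by (rule closedin_zariski_closure)
    show "integral_on n (zariski_closure n (toric_set n a b i0 e c (S k)))" for k
      by (intro integral_on_closure toric_set_subset_affine integral_on_toric_set) (simp add: S_def)
    show "zariski_closure n (toric_set n a b i0 e c (S k)) \<subset>
      zariski_closure n (toric_set n a b i0 e c (S (Suc k)))" if "k < n - 2" for k
      using strict[OF that] S[of "Suc k"] that assms(2) by (intro toric_closure_strict_mono) auto
    have "S (n - 2) = {1..<n} - {i0}" using g unfolding S_def bij_betw_def by blast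
    then show "zariski_closure n (toric_set n a b i0 e c (S (n - 2)))
      \<subseteq> zariski_closure n (toric_set n a b i0 e c ({1..<n} - {i0}))" by simp
  qed
qed

section \<open>The binomial locus\<close>

text \<open>
  The center, if the monoid is noncommutative.  The equation is symmetric in \<open>a\<close> and \<open>b\<close>, so an
  index where the exponents differ may be assumed to satisfy \<open>b i0 < a i0\<close>.
\<close>

definition binomial_locus :: "nat \<Rightarrow> (nat \<Rightarrow> nat) \<Rightarrow> (nat \<Rightarrow> nat) \<Rightarrow> (nat \<Rightarrow> 'k::field) set" where
  "binomial_locus n a b = {x \<in> affine_space n. x n = 0 \<and> monomial n a x = monomial n b x}"

lemma binomial_locus_commute: "binomial_locus n a b = binomial_locus n b a"
  by (auto simp: binomial_locus_def)

lemma closedin_binomial_locus: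
  assumes "n \<ge> 1" shows "closedin (zariski n) (binomial_locus n a b :: (nat \<Rightarrow> 'k::field) set)"
proof -
  let ?f = "\<lambda>x :: nat \<Rightarrow> 'k. monomial n a x + (-1) * monomial n b x"
  have "?f \<in> poly_funs n"
    by (intro poly_funs.add poly_funs.mult poly_funs.const monomial_in_poly_funs)
  moreover have "(\<lambda>x :: nat \<Rightarrow> 'k. x n) \<in> poly_funs n" using assms by (intro poly_funs.coord) simp
  ultimately have "{\<lambda>x. x n, ?f} \<subseteq> poly_funs n" by simp
  moreover have "binomial_locus n a b = zero_locus n {\<lambda>x. x n, ?f}"
    by (auto simp: binomial_locus_def zero_locus_def)
  ultimately show ?thesis unfolding closedin_zariski by (intro exI conjI)
qed

lemma monomial_toric:
  assumes "i0 \<in> {1..<n}" "t i0 = 1" "\<And>i. i \<in> {1..<n} - {i0} \<Longrightarrow> x i = t i ^ e"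
  shows "monomial n a x = x i0 ^ a i0 * monomial n a t ^ e"
proof -
  have "monomial n a x = x i0 ^ a i0 * (\<Prod>i\<in>{1..<n} - {i0}. x i ^ a i)"
    unfolding monomial_def using assms(1) by (intro prod.remove) auto
  also have "(\<Prod>i\<in>{1..<n} - {i0}. x i ^ a i) = (\<Prod>i\<in>{1..<n} - {i0}. t i ^ a i) ^ e"
    unfolding prod_power_distrib
    by (intro prod.cong) (auto simp: assms(3) mult.commute simp flip: power_mult)
  also have "(\<Prod>i\<in>{1..<n} - {i0}. t i ^ a i) = monomial n a t"
    unfolding monomial_def using assms(1,2) by (subst prod.remove[of _ i0]) auto
  finally show ?thesis .
qed

lemma toric_set_subset_binomial_locus:
  assumes "i0 \<in> {1..<n}" "a i0 = b i0 + e" "c ^ e = 1"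
  shows "toric_set n a b i0 e c ({1..<n} - {i0}) \<subseteq> binomial_locus n a b"
proof
  fix x assume "x \<in> toric_set n a b i0 e c ({1..<n} - {i0})"
  then obtain t where t: "t \<in> partial_torus ({1..<n} - {i0})" "x = toric_point n a b i0 e c t"
    unfolding toric_set_def by blast
  define \<alpha> \<beta> where ab: "\<alpha> = monomial n a t" "\<beta> = monomial n b t"
  have nz: "\<alpha> \<noteq> 0" "\<beta> \<noteq> 0" using t(1) monomial_partial_torus_nonzero unfolding ab by blast+
  have "t i0 = 1" using t(1) by (simp add: partial_torus_def)
  moreover have "x i = t i ^ e" if "i \<in> {1..<n} - {i0}" for i
    using that by (simp add: t(2) toric_point_def)
  ultimately have mon: "monomial n a x = x i0 ^ a i0 * \<alpha> ^ e" "monomial n b x = x i0 ^ b i0 * \<beta> ^ e"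
    unfolding ab by (intro monomial_toric assms(1); simp)+
  have x0: "x i0 = c * \<beta> / \<alpha>" using assms(1) by (simp add: t(2) toric_point_def ab)
  have "x i0 ^ e * \<alpha> ^ e = \<beta> ^ e"
    using nz assms(3) by (simp add: x0 power_divide power_mult_distrib)
  then have "monomial n a x = monomial n b x"
    unfolding mon assms(2) power_add by (simp add: mult.assoc)
  moreover have "x n = 0" "x \<in> affine_space n"
    using assms(1) by (auto simp: t(2) toric_point_def affine_space_def)
  ultimately show "x \<in> binomial_locus n a b" by (simp add: binomial_locus_def)
qed

lemma coordinate_set_subset_binomial_locus:
  assumes "j \<in> {1..<n}" "a j > 0" "b j > 0"
  shows "toric_set n a b j 1 0 S \<subseteq> binomial_locus n a b"
proof
  fix x assume "x \<in> toric_set n a b j 1 0 S"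
  then have x: "x j = 0" "x n = 0" "x \<in> affine_space n"
    using assms(1) by (auto simp: toric_set_def toric_point_def affine_space_def)
  then have "monomial n a x = 0" "monomial n b x = 0"
    unfolding monomial_eq_0_iff using assms by blast+
  then show "x \<in> binomial_locus n a b" using x by (simp add: binomial_locus_def)
qed

text \<open>
  Conversely, a solution without zero coordinates is reached by choosing \<open>e\<close>-th roots \<open>t i\<close> of its
  coordinates: \<open>x\<^sup>a = x\<^sup>b\<close> then says that the factor \<open>c\<close> that is left at \<open>i0\<close> is an \<open>e\<close>-th root of
  unity.  Since all roots of unity are admitted, the exponents need not be coprime; the pieces for
  different \<open>c\<close> may coincide.
\<close>

lemma binomial_torus_in_toric_set:
  fixes x :: "nat \<Rightarrow> 'k::{alg_closed_field, field_char_0}"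
  assumes "i0 \<in> {1..<n}" "a i0 = b i0 + e" "e > 0"
    and x: "x \<in> binomial_locus n a b" "\<And>i. i \<in> {1..<n} \<Longrightarrow> x i \<noteq> 0"
  shows "\<exists>c. c ^ e = 1 \<and> x \<in> toric_set n a b i0 e c ({1..<n} - {i0})"
proof -
  have "\<exists>y. y ^ e = x i" for i using assms(3) by (rule nth_root_exists)
  then obtain s where s: "\<And>i. s i ^ e = x i" by metis
  define t where "t i = (if i \<in> {1..<n} - {i0} then s i else 1)" for i
  have "s i \<noteq> 0" if "i \<in> {1..<n}" for i using s[of i] x(2)[OF that] assms(3) by (auto simp: power_0_left)
  then have t: "t \<in> partial_torus ({1..<n} - {i0})" by (auto simp: partial_torus_def t_def)
  define \<alpha> \<beta> where ab: "\<alpha> = monomial n a t" "\<beta> = monomial n b t"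
  have nz: "\<alpha> \<noteq> 0" "\<beta> \<noteq> 0" using t monomial_partial_torus_nonzero unfolding ab by blast+
  have tx: "x i = t i ^ e" if "i \<in> {1..<n} - {i0}" for i
    using that s by (simp add: t_def)
  have ti0: "t i0 = 1" by (simp add: t_def)
  have mon: "monomial n a x = x i0 ^ a i0 * \<alpha> ^ e" "monomial n b x = x i0 ^ b i0 * \<beta> ^ e"
    unfolding ab by (intro monomial_toric assms(1) ti0 tx; simp)+
  define c where "c = x i0 * \<alpha> / \<beta>"
  have "x i0 ^ b i0 * (x i0 ^ e * \<alpha> ^ e) = x i0 ^ b i0 * \<beta> ^ e"
    using x(1) unfolding binomial_locus_def by (simp add: mon assms(2) power_add mult.assoc)
  then have "x i0 ^ e * \<alpha> ^ e = \<beta> ^ e" using x(2)[OF assms(1)] by simp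
  then have "c ^ e = 1" using nz by (simp add: c_def power_divide power_mult_distrib)
  moreover have "x = toric_point n a b i0 e c t"
  proof
    fix i
    consider "i \<notin> {1..n}" | "i = n" "i \<in> {1..n}" | "i = i0" | "i \<in> {1..<n} - {i0}" by fastforce
    then show "x i = toric_point n a b i0 e c t i"
    proof cases
      case 1 then show ?thesis
        using x(1) by (auto simp: binomial_locus_def affine_space_def toric_point_def)
    next
      case 2 then show ?thesis using x(1) by (simp add: binomial_locus_def toric_point_def)
    next
      case 3 then show ?thesis using assms(1) nz by (simp add: toric_point_def c_def flip: ab)
    next
      case 4 then show ?thesis using tx by (simp add: toric_point_def)
    qed
  qed
  ultimately show ?thesis using t unfolding toric_set_def by blast
qed

lemma in_coordinate_set:
  fixes x :: "nat \<Rightarrow> 'k::field"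
  assumes "j \<in> {1..<n}" "x \<in> affine_space n" "x n = 0" "x j = 0"
    "\<And>i. i \<in> {1..<n} - {j} \<Longrightarrow> x i \<noteq> 0"
  shows "x \<in> toric_set n a b j 1 0 ({1..<n} - {j})"
proof -
  define t where "t i = (if i \<in> {1..<n} - {j} then x i else 1)" for i
  have "t \<in> partial_torus ({1..<n} - {j})" using assms(5) by (auto simp: partial_torus_def t_def)
  moreover have "x = toric_point n a b j 1 0 t"
  proof
    fix i
    show "x i = toric_point n a b j 1 0 t i"
      using assms by (cases "i \<in> {1..n}") (auto simp: toric_point_def t_def affine_space_def)
  qed
  ultimately show ?thesis unfolding toric_set_def by blast
qed

text \<open>
  Only the coordinate \<open>i1\<close> has to be rescaled, by a root of \<open>Y / X\<close>; it contributes to the left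
  side alone because \<open>b i1 = 0\<close>.
\<close>

lemma exists_balancing_scaling:
  fixes X Y :: "'k::{alg_closed_field, field_char_0}"
  assumes "finite V" "X \<noteq> 0" "Y \<noteq> 0" "i1 \<in> V" "a i1 > 0" "b i1 = 0"
  shows "\<exists>c. (\<forall>i. c i \<noteq> 0) \<and> X * (\<Prod>i\<in>V. c i ^ a i) = Y * (\<Prod>i\<in>V. c i ^ b i)"
proof -
  obtain r where r: "r ^ a i1 = Y / X" using nth_root_exists[OF assms(5)] by metis
  then have "r \<noteq> 0" using assms by (cases "r = 0") (auto simp: power_0_left)
  define c where "c i = (if i = i1 then r else 1)" for i
  have *: "(\<Prod>i\<in>V. c i ^ d i) = r ^ d i1" for d
  proof -
    have "(\<Prod>i\<in>V. c i ^ d i) = (\<Prod>i\<in>V. if i = i1 then r ^ d i else 1)"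
      by (rule prod.cong) (auto simp: c_def)
    then show ?thesis using assms(1,4) by simp
  qed
  have "X * (\<Prod>i\<in>V. c i ^ a i) = Y * (\<Prod>i\<in>V. c i ^ b i)"
    unfolding * using r assms by simp
  moreover have "c i \<noteq> 0" for i using \<open>r \<noteq> 0\<close> by (simp add: c_def)
  ultimately show ?thesis by blast
qed

text \<open>
  A solution \<open>x\<close> whose zero coordinates never have both exponents positive is a limit of solutions
  without zero coordinates.  Let \<open>V\<close> be the set of zero coordinates of \<open>x\<close>, and replace them by
  \<open>c i * \<tau> ^ d i\<close>.  The weights \<open>d\<close> are chosen so that both sides of the equation have the same
  order \<open>A * B\<close> in \<open>\<tau>\<close>, where \<open>A\<close> and \<open>B\<close> are the sums of the exponents \<open>a\<close> and \<open>b\<close> over \<open>V\<close>; the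
  constants \<open>c\<close> then make the leading coefficients equal.
\<close>

lemma binomial_torus_dense:
  fixes x :: "nat \<Rightarrow> 'k::{alg_closed_field, field_char_0}"
  assumes "n \<ge> 1" "x \<in> binomial_locus n a b"
    and sep: "\<And>i. i \<in> {1..<n} \<Longrightarrow> x i = 0 \<Longrightarrow> a i = 0 \<or> b i = 0"
  shows "x \<in> zariski_closure n {y \<in> binomial_locus n a b. \<forall>i\<in>{1..<n}. y i \<noteq> 0}"
proof -
  define V where "V = {i \<in> {1..<n}. x i = 0}"
  have V: "finite V" "V \<subseteq> {1..<n}" by (auto simp: V_def)
  define A B where AB: "A = (\<Sum>i\<in>V. a i)" "B = (\<Sum>i\<in>V. b i)"
  define d where "d i = (if a i > 0 then B else if b i > 0 then A else 1)" for i
  have x: "x \<in> affine_space n" "x n = 0" "monomial n a x = monomial n b x"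
    using assms(2) by (auto simp: binomial_locus_def)
  have A0: "monomial n a x = 0 \<longleftrightarrow> A > 0" and B0: "monomial n b x = 0 \<longleftrightarrow> B > 0"
    using V(1) by (auto simp: monomial_eq_0_iff AB V_def sum_eq_0_iff simp flip: neq0_conv)
  \<comment> \<open>Both sides vanish at \<open>x\<close> or neither does, so \<open>A\<close> and \<open>B\<close> are both positive or both zero.\<close>
  have d_pos: "d i > 0" if i: "i \<in> V" for i
  proof -
    have "a i \<le> A" "b i \<le> B" unfolding AB using V(1) i by (auto intro: member_le_sum)
    then show ?thesis using A0 B0 x(3) by (auto simp: d_def)
  qed
  have da: "(\<Sum>i\<in>V. d i * a i) = A * B"
    unfolding AB(1) sum_distrib_right by (rule sum.cong) (auto simp: d_def)
  have db: "(\<Sum>i\<in>V. d i * b i) = A * B"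
    unfolding AB(2) sum_distrib_left
  proof (rule sum.cong)
    fix i assume "i \<in> V"
    then have "a i = 0 \<or> b i = 0" using sep by (simp add: V_def)
    then show "d i * b i = A * b i" by (auto simp: d_def)
  qed simp
  \<comment> \<open>The part of a monomial that involves the nonzero coordinates only; it is constant on the curve.\<close>
  define R where "R e = (\<Prod>i\<in>{1..<n} - V. x i ^ e i)" for e :: "nat \<Rightarrow> nat"
  have R_nz: "R e \<noteq> 0" for e by (auto simp: R_def V_def)
  have split: "monomial n e y = R e * (\<Prod>i\<in>V. y i ^ e i)"
    if "\<And>i. i \<in> {1..<n} - V \<Longrightarrow> y i = x i" for e y
  proof -
    have "monomial n e y = (\<Prod>i\<in>{1..<n} - V. y i ^ e i) * (\<Prod>i\<in>V. y i ^ e i)"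
      unfolding monomial_def using V by (intro prod.subset_diff) auto
    also have "(\<Prod>i\<in>{1..<n} - V. y i ^ e i) = R e"
      unfolding R_def by (rule prod.cong) (auto simp: that)
    finally show ?thesis .
  qed
  have "\<exists>c. (\<forall>i. c i \<noteq> 0) \<and> R a * (\<Prod>i\<in>V. c i ^ a i) = R b * (\<Prod>i\<in>V. c i ^ b i)"
  proof (cases "A = 0")
    case True
    then have "B = 0" using A0 B0 x(3) by auto
    then have "\<forall>i\<in>V. a i = 0 \<and> b i = 0" using True V(1) by (simp add: AB)
    then have "R a = R b" using x(3) split[of x a] split[of x b] by simp
    then show ?thesis by (intro exI[of _ "\<lambda>_. 1"]) simp
  next
    case False
    then obtain i1 where i1: "i1 \<in> V" "a i1 \<noteq> 0" unfolding AB(1) by (metis sum.neutral)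
    then have "b i1 = 0" using sep[of i1] by (auto simp: V_def)
    then show ?thesis using i1 V(1) R_nz by (intro exists_balancing_scaling) auto
  qed
  then obtain c where c: "\<And>i. c i \<noteq> 0" "R a * (\<Prod>i\<in>V. c i ^ a i) = R b * (\<Prod>i\<in>V. c i ^ b i)"
    by blast
  define \<gamma> where "\<gamma> \<tau> = (\<lambda>i\<in>{1..n}. if i \<in> V then c i * \<tau> ^ d i else x i)" for \<tau>
  have mon: "monomial n e (\<gamma> \<tau>) = R e * (\<Prod>i\<in>V. c i ^ e i) * \<tau> ^ (\<Sum>i\<in>V. d i * e i)" for e \<tau>
  proof -
    have "monomial n e (\<gamma> \<tau>) = R e * (\<Prod>i\<in>V. \<gamma> \<tau> i ^ e i)"
      by (rule split) (auto simp: \<gamma>_def)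
    also have "(\<Prod>i\<in>V. \<gamma> \<tau> i ^ e i) = (\<Prod>i\<in>V. c i ^ e i * \<tau> ^ (d i * e i))"
      by (rule prod.cong) (use V(2) in \<open>auto simp: \<gamma>_def power_mult_distrib power_mult\<close>)
    finally show ?thesis by (simp add: prod.distrib power_sum mult.assoc)
  qed
  have "\<gamma> 0 = x"
  proof
    fix i show "\<gamma> 0 i = x i"
      using x(1) d_pos[of i] by (auto simp: \<gamma>_def affine_space_def V_def zero_power)
  qed
  moreover have "\<gamma> 0 \<in> zariski_closure n {y \<in> binomial_locus n a b. \<forall>i\<in>{1..<n}. y i \<noteq> 0}"
  proof (rule curve_start_in_closure)
    show "\<gamma> 0 \<in> affine_space n" by (auto simp: \<gamma>_def affine_space_def)
    show "rational_on UNIV (\<lambda>\<tau>. \<gamma> \<tau> i)" if "i \<in> {1..n}" for i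
      using that rational_on_const[of UNIV "x i"]
        rational_on_mult[OF rational_on_const[of UNIV "c i"] rational_on_power[OF rational_on_id, where k = "d i"]]
      by (cases "i \<in> V") (simp_all add: \<gamma>_def)
    fix \<tau> :: 'k assume \<tau>: "\<tau> \<noteq> 0"
    have "monomial n a (\<gamma> \<tau>) = monomial n b (\<gamma> \<tau>)" unfolding mon da db c(2) ..
    moreover have "\<gamma> \<tau> n = 0" "\<gamma> \<tau> \<in> affine_space n"
      using x(2) assms(1) V(2) by (auto simp: \<gamma>_def affine_space_def)
    moreover have "\<gamma> \<tau> i \<noteq> 0" if "i \<in> {1..<n}" for i
      using that c(1) \<tau> by (auto simp: \<gamma>_def V_def)
    ultimately show "\<gamma> \<tau> \<in> {y \<in> binomial_locus n a b. \<forall>i\<in>{1..<n}. y i \<noteq> 0}"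
      by (simp add: binomial_locus_def)
  qed
  ultimately show ?thesis by simp
qed

lemma in_coordinate_closure:
  fixes x :: "nat \<Rightarrow> 'k::field_char_0"
  assumes "j \<in> {1..<n}" "x \<in> affine_space n" "x n = 0" "x j = 0"
  shows "x \<in> zariski_closure n (toric_set n a b j 1 0 ({1..<n} - {j}))"
proof -
  define \<gamma> where "\<gamma> \<tau> = (\<lambda>i\<in>{1..n}. if x i = 0 \<and> i \<noteq> j \<and> i \<noteq> n then \<tau> else x i)" for \<tau>
  have "\<gamma> 0 = x"
  proof
    fix i show "\<gamma> 0 i = x i" using assms(2) by (auto simp: \<gamma>_def affine_space_def)
  qed
  moreover have "\<gamma> 0 \<in> zariski_closure n (toric_set n a b j 1 0 ({1..<n} - {j}))"
  proof (rule curve_start_in_closure)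
    show "\<gamma> 0 \<in> affine_space n" by (auto simp: \<gamma>_def affine_space_def)
    show "rational_on UNIV (\<lambda>\<tau>. \<gamma> \<tau> i)" if "i \<in> {1..n}" for i
    proof (cases "x i = 0 \<and> i \<noteq> j \<and> i \<noteq> n")
      case True
      then have "(\<lambda>\<tau>. \<gamma> \<tau> i) = (\<lambda>\<tau>. \<tau>)" using that by (auto simp: \<gamma>_def)
      then show ?thesis by (simp only: rational_on_id)
    next
      case False
      then have "(\<lambda>\<tau>. \<gamma> \<tau> i) = (\<lambda>\<tau>. x i)" using that by (auto simp: \<gamma>_def)
      then show ?thesis by (simp only: rational_on_const)
    qed
    show "\<gamma> \<tau> \<in> toric_set n a b j 1 0 ({1..<n} - {j})" if "\<tau> \<noteq> 0" for \<tau>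
      using assms that by (intro in_coordinate_set) (auto simp: \<gamma>_def affine_space_def)
  qed
  ultimately show ?thesis by simp
qed

text \<open>
  There are two kinds of pieces.  If both exponents at \<open>j\<close> are positive, the whole coordinate
  subspace \<open>x j = x n = 0\<close> lies in the locus.  A solution outside these subspaces is a limit of
  solutions without zero coordinates, and those form finitely many toric sets, one for each root
  of unity.
\<close>

lemma binomial_locus_cover:
  assumes "i0 \<in> {1..<n}" "b i0 < a i0"
  shows "\<exists>I :: (nat \<times> nat \<times> 'k::{alg_closed_field, field_char_0}) set. finite I \<and>
    (\<forall>(j, e, c)\<in>I. j \<in> {1..<n} \<and> e > 0 \<and> toric_set n a b j e c ({1..<n} - {j}) \<subseteq> binomial_locus n a b) \<and>
    binomial_locus n a b \<subseteq> (\<Union>(j, e, c)\<in>I. zariski_closure n (toric_set n a b j e c ({1..<n} - {j})))"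
proof -
  define e where "e = a i0 - b i0"
  have e: "a i0 = b i0 + e" "e > 0" using assms(2) by (auto simp: e_def)
  define W :: "'k set" where "W = {c. c ^ e = 1}"
  define J where "J = {j \<in> {1..<n}. a j > 0 \<and> b j > 0}"
  define I where "I = (\<lambda>c. (i0, e, c)) ` W \<union> (\<lambda>j. (j, 1, 0 :: 'k)) ` J"
  let ?Y = "{y \<in> binomial_locus n a b. \<forall>i\<in>{1..<n}. y i \<noteq> 0} :: (nat \<Rightarrow> 'k) set"
  let ?K = "\<lambda>(j, e, c :: 'k). zariski_closure n (toric_set n a b j e c ({1..<n} - {j}))"
  have "finite W"
  proof (rule finite_subset)
    show "W \<subseteq> {c. poly (monom 1 e - 1) c = 0}" by (auto simp: W_def poly_monom)
    have "coeff (monom (1::'k) e - 1) e = 1" using e(2) by (simp add: coeff_1)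
    then have "monom (1::'k) e - 1 \<noteq> 0" by (metis coeff_0 zero_neq_one)
    then show "finite {c. poly (monom (1::'k) e - 1) c = 0}" by (rule poly_roots_finite)
  qed
  then have fin: "finite I" by (simp add: I_def J_def)
  have "x \<in> (\<Union>i\<in>I. ?K i)" if x: "x \<in> binomial_locus n a b" for x :: "nat \<Rightarrow> 'k"
  proof (cases "\<exists>j\<in>J. x j = 0")
    case True
    then obtain j where j: "j \<in> J" "x j = 0" by blast
    then have "x \<in> ?K (j, 1, 0)"
      using x in_coordinate_closure[of j n x a b] by (simp add: J_def binomial_locus_def)
    moreover have "(j, 1, 0) \<in> I" using j by (simp add: I_def)
    ultimately show ?thesis by blast
  next
    case False
    then have "x \<in> zariski_closure n ?Y"
      using x assms(1) by (intro binomial_torus_dense) (auto simp: J_def)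
    moreover have "zariski_closure n ?Y \<subseteq> (\<Union>i\<in>I. ?K i)"
    proof (rule zariski_closure_minimal)
      show "?Y \<subseteq> (\<Union>i\<in>I. ?K i)"
      proof
        fix y :: "nat \<Rightarrow> 'k" assume "y \<in> ?Y"
        then obtain c where c: "c ^ e = 1" "y \<in> toric_set n a b i0 e c ({1..<n} - {i0})"
          using binomial_torus_in_toric_set[of i0 n a b e, OF assms(1) e] by blast
        then have "y \<in> ?K (i0, e, c)"
          using subsetD[OF zariski_closure_superset[OF toric_set_subset_affine] c(2)] by simp
        moreover have "(i0, e, c) \<in> I" using c(1) by (simp add: I_def W_def)
        ultimately show "y \<in> (\<Union>i\<in>I. ?K i)" by blast
      qed
      show "closedin (zariski n) (\<Union>i\<in>I. ?K i)"
        using fin by (intro closedin_Union) (auto intro: closedin_zariski_closure)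
    qed
    ultimately show ?thesis by blast
  qed
  then have "binomial_locus n a b \<subseteq> (\<Union>i\<in>I. ?K i)" by blast
  moreover have "\<forall>(j, e, c)\<in>I. j \<in> {1..<n} \<and> e > 0 \<and>
      toric_set n a b j e c ({1..<n} - {j}) \<subseteq> binomial_locus n a b"
  proof -
    have "toric_set n a b i0 e c ({1..<n} - {i0}) \<subseteq> binomial_locus n a b" if "c \<in> W" for c
      using assms(1) e(1) that by (intro toric_set_subset_binomial_locus) (simp_all add: W_def)
    moreover have "j \<in> {1..<n} \<and> toric_set n a b j 1 (0::'k) ({1..<n} - {j}) \<subseteq> binomial_locus n a b"
      if "j \<in> J" for j
      using that coordinate_set_subset_binomial_locus[of j n a b] unfolding J_def by blast
    ultimately show ?thesis using assms(1) e(2) by (simp add: I_def ball_Un)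
  qed
  ultimately show ?thesis using fin by blast
qed

section \<open>Irreducible components and their dimension\<close>

text \<open>
  By maximality, a component that is contained in one of the irreducible closed sets is equal to it.
\<close>

lemma irreducible_component_cases:
  fixes Z :: "(nat \<Rightarrow> 'k::idom) set"
  assumes "closedin (zariski n) Z" "C \<in> irreducible_components (subtopology (zariski n) Z)"
    and "finite I" "\<And>i. i \<in> I \<Longrightarrow> closedin (zariski n) (K i) \<and> integral_on n (K i) \<and> K i \<subseteq> Z"
    and "Z \<subseteq> (\<Union>i\<in>I. K i)"
  shows "\<exists>i\<in>I. C = K i"
proof -
  have Z: "Z \<subseteq> affine_space n" using closedin_subset[OF assms(1)] by (simp add: topspace_zariski)
  have ts: "topspace (subtopology (zariski n) Z) = Z" using Z by (auto simp: topspace_zariski)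
  have irr: "irreducible_space (subtopology (subtopology (zariski n) Z) D) \<longleftrightarrow> integral_on n D"
    if "D \<subseteq> Z" for D
    using that Z irreducible_space_zariski_iff[of D n] by (simp add: subtopology_subtopology Int_absorb1)
  have C: "C \<subseteq> Z" "integral_on n C" "\<And>D. D \<subseteq> Z \<Longrightarrow> integral_on n D \<Longrightarrow> C \<subseteq> D \<Longrightarrow> D = C"
    using assms(2) irr unfolding irreducible_components_def ts mem_Collect_eq by metis+
  obtain i where "i \<in> I" "C \<subseteq> K i"
    using integral_on_subset_Union[OF assms(3) C(2), of K] assms(4,5) C(1) by blast
  then show ?thesis using C(3)[of "K i"] assms(4) by blast
qed

lemma integral_on_coordinate_subspace:
  "integral_on n {x :: nat \<Rightarrow> 'k::field_char_0. x \<in> affine_space n \<and> (\<forall>i\<in>T. x i = 0)}" if "T \<subseteq> {1..n}"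
proof (rule integral_on_if_curves)
  let ?H = "{x :: nat \<Rightarrow> 'k. x \<in> affine_space n \<and> (\<forall>i\<in>T. x i = 0)}"
  have "(\<lambda>i\<in>{1..n}. 0) \<in> ?H" using that by (auto simp: affine_space_def)
  then show "?H \<noteq> {}" by blast
  fix x y assume xy: "x \<in> ?H" "y \<in> ?H"
  define \<gamma> where "\<gamma> \<tau> = (\<lambda>i\<in>{1..n}. x i + \<tau> * (y i + (- x i)))" for \<tau>
  have "x = \<gamma> 0" "y = \<gamma> 1"
    using xy by (auto simp: \<gamma>_def affine_space_def fun_eq_iff)
  then have "x \<in> range \<gamma>" "y \<in> range \<gamma>" by blast+
  moreover have "\<gamma> \<tau> \<in> ?H" for \<tau> using xy that by (auto simp: \<gamma>_def affine_space_def)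
  moreover have "rational_on UNIV (\<lambda>\<tau>. \<gamma> \<tau> i)" if "i \<in> {1..n}" for i
  proof -
    have "(\<lambda>\<tau>. \<gamma> \<tau> i) = (\<lambda>\<tau>. x i + \<tau> * (y i + (- x i)))" using that by (simp add: \<gamma>_def)
    then show ?thesis
      by (simp only:) (intro rational_on_add rational_on_mult rational_on_const rational_on_id)
  qed
  ultimately show "\<exists>U \<gamma>. infinite U \<and> (\<forall>i\<in>{1..n}. rational_on U (\<lambda>\<tau>. \<gamma> \<tau> i)) \<and>
      (\<forall>\<tau>\<in>U. \<gamma> \<tau> \<in> ?H) \<and> x \<in> \<gamma> ` U \<and> y \<in> \<gamma> ` U"
    using infinite_UNIV_char_0 by (intro exI[of _ UNIV] exI[of _ \<gamma>]) simp
qed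

lemma closedin_coordinate_subspace:
  assumes "T \<subseteq> {1..n}"
  shows "closedin (zariski n) {x :: nat \<Rightarrow> 'k::idom. x \<in> affine_space n \<and> (\<forall>i\<in>T. x i = 0)}"
proof -
  have "(\<lambda>i x. x i) ` T \<subseteq> poly_funs n" using assms by (intro image_subsetI poly_funs.coord) blast
  moreover have "{x :: nat \<Rightarrow> 'k. x \<in> affine_space n \<and> (\<forall>i\<in>T. x i = 0)} = zero_locus n ((\<lambda>i x. x i) ` T)"
    by (simp add: zero_locus_def)
  ultimately show ?thesis unfolding closedin_zariski by (intro exI conjI)
qed

lemma binomial_locus_psubset_hyperplane:
  assumes "i0 \<in> {1..<n}" "a i0 \<noteq> b i0"
  shows "(binomial_locus n a b :: (nat \<Rightarrow> 'k::field_char_0) set) \<subset> {x \<in> affine_space n. \<forall>i\<in>{n}. x i = 0}"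
proof -
  define y :: "nat \<Rightarrow> 'k" where "y = (\<lambda>i\<in>{1..n}. if i = n then 0 else if i = i0 then 2 else 1)"
  have mon: "monomial n d y = 2 ^ d i0" for d
  proof -
    have "monomial n d y = (\<Prod>i\<in>{1..<n}. if i = i0 then 2 ^ d i else 1)"
      unfolding monomial_def by (rule prod.cong) (auto simp: y_def)
    then show ?thesis using assms(1) by simp
  qed
  have "y \<in> {x \<in> affine_space n. \<forall>i\<in>{n}. x i = 0}"
    using assms(1) by (auto simp: y_def affine_space_def)
  moreover have "y \<notin> binomial_locus n a b"
    using assms(2) by (simp add: binomial_locus_def mon two_power_eq_iff)
  ultimately show ?thesis by (auto simp: binomial_locus_def)
qed

text \<open>
  The locus lies strictly inside the hyperplane \<open>x n = 0\<close>, which lies strictly inside affine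
  space.  Both are irreducible, so a chain of length \<open>k\<close> in \<open>C\<close> extends to one of length \<open>k + 2\<close>
  in affine space.
\<close>

lemma krull_dim_le_binomial_locus:
  fixes C :: "(nat \<Rightarrow> 'k::field_char_0) set"
  assumes "i0 \<in> {1..<n}" "a i0 \<noteq> b i0" "C \<subseteq> binomial_locus n a b" "closedin (zariski n) C"
  shows "krull_dim (subtopology (zariski n) C) \<le> enat (n - 2)"
  unfolding krull_dim_def
proof (rule Sup_least, clarify)
  fix k D
  assume D: "\<forall>i\<le>k. closedin (subtopology (zariski n) C) (D i) \<and>
      irreducible_space (subtopology (subtopology (zariski n) C) (D i))"
    and strict: "\<forall>i<k. D i \<subset> D (Suc i)"
  let ?H = "{x :: nat \<Rightarrow> 'k. x \<in> affine_space n \<and> (\<forall>i\<in>{n}. x i = 0)}"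
  have n: "{n} \<subseteq> {1..n}" "n \<ge> 2" using assms(1) by auto
  have cl: "closedin (zariski n) (D i)" "D i \<subseteq> C" if "i \<le> k" for i
    using D that assms(4) closedin_closed_subtopology by blast+
  have int: "integral_on n (D i)" if "i \<le> k" for i
  proof -
    have "D i \<subseteq> affine_space n" using closedin_subset[OF cl(1)[OF that]] by (simp add: topspace_zariski)
    moreover have "irreducible_space (subtopology (zariski n) (C \<inter> D i))"
      using D that by (simp add: subtopology_subtopology)
    moreover have "C \<inter> D i = D i" using cl(2)[OF that] by blast
    ultimately show ?thesis using irreducible_space_zariski_iff[of "D i" n] by simp
  qed
  define E where "E i = (if i \<le> k then D i else if i = Suc k then ?H else affine_space n)" for i
  have A: "(affine_space n :: (nat \<Rightarrow> 'k) set) = {x \<in> affine_space n. \<forall>i\<in>{}. x i = 0}" by simp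
  have "k + 2 \<le> n"
  proof (rule chain_length_le[of "k + 2" n E])
    fix i
    show "closedin (zariski n) (E i)"
      using cl(1) closedin_coordinate_subspace[OF n(1)] closedin_coordinate_subspace[of "{}" n] A
      by (auto simp: E_def)
    show "integral_on n (E i)"
      using int integral_on_coordinate_subspace[OF n(1)] integral_on_coordinate_subspace[of "{}" n] A
      by (auto simp: E_def)
    assume "i < k + 2"
    then consider "i < k" | "i = k" | "i = Suc k" by linarith
    then show "E i \<subset> E (Suc i)"
    proof cases
      case 1 then show ?thesis using strict by (simp add: E_def)
    next
      case 2
      have "D k \<subset> ?H"
        using cl(2)[of k] assms(3) binomial_locus_psubset_hyperplane[of i0 n a b, OF assms(1,2)] by blast
      then show ?thesis using 2 by (simp add: E_def)
    next
      case 3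
      have "(\<lambda>i\<in>{1..n}. 1) \<in> affine_space n - ?H" using n by (auto simp: affine_space_def)
      then have "?H \<subset> affine_space n" by blast
      then show ?thesis using 3 by (simp add: E_def)
    qed
  qed
  then show "enat k \<le> enat (n - 2)" by simp
qed

lemma binomial_locus_component_dim:
  assumes i0: "i0 \<in> {1..<n}" "b i0 < a i0"
    and C: "C \<in> irreducible_components (subtopology (zariski n)
      (binomial_locus n a b :: (nat \<Rightarrow> 'k::{alg_closed_field, field_char_0}) set))"
  shows "krull_dim (subtopology (zariski n) C) + 2 = enat n"
proof -
  let ?Z = "binomial_locus n a b :: (nat \<Rightarrow> 'k) set"
  let ?T = "\<lambda>j e (c::'k). toric_set n a b j e c ({1..<n} - {j})"
  have Z: "closedin (zariski n) ?Z" using i0(1) by (intro closedin_binomial_locus) simp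
  obtain I :: "(nat \<times> nat \<times> 'k) set" where I: "finite I"
    "\<And>j e c. (j, e, c) \<in> I \<Longrightarrow> j \<in> {1..<n} \<and> e > 0 \<and> ?T j e c \<subseteq> ?Z"
    "?Z \<subseteq> (\<Union>(j, e, c)\<in>I. zariski_closure n (?T j e c))"
    using binomial_locus_cover[of i0 n b a, OF i0] by fast
  have K: "closedin (zariski n) (zariski_closure n (?T j e c)) \<and>
      integral_on n (zariski_closure n (?T j e c)) \<and> zariski_closure n (?T j e c) \<subseteq> ?Z"
    if "(j, e, c) \<in> I" for j e c
    using I(2)[OF that] Z
    by (intro conjI closedin_zariski_closure integral_on_closure toric_set_subset_affine
        integral_on_toric_set zariski_closure_minimal) auto
  have "\<exists>i\<in>I. C = (\<lambda>(j, e, c). zariski_closure n (?T j e c)) i"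
    using Z C I(1) _ I(3) by (rule irreducible_component_cases) (use K in auto)
  then obtain j e c where jec: "(j, e, c) \<in> I" "C = zariski_closure n (?T j e c)" by auto
  have "enat (n - 2) \<le> krull_dim (subtopology (zariski n) C)"
    unfolding jec(2) using I(2)[OF jec(1)] by (intro krull_dim_toric_closure_ge) auto
  moreover have "krull_dim (subtopology (zariski n) C) \<le> enat (n - 2)"
    using i0 K[OF jec(1)] unfolding jec(2) by (intro krull_dim_le_binomial_locus[of i0 n a b]) auto
  ultimately have "krull_dim (subtopology (zariski n) C) = enat (n - 2)" by (rule antisym[rotated])
  moreover have "2 \<le> n" using i0(1) by simp
  then have "n - 2 + 2 = n" by simp
  ultimately show ?thesis by (simp only: numeral_eq_enat plus_enat_simps)
qed

section \<open>The center\<close>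

lemma noncommutative_exponents_differ:
  assumes "n \<ge> 1" "\<not> comm_monoid (affine_monoid n a b :: (nat \<Rightarrow> 'k::comm_ring_1) monoid)"
  shows "\<exists>i\<in>{1..<n}. a i \<noteq> b i"
proof (rule ccontr)
  let ?M = "affine_monoid n a b :: (nat \<Rightarrow> 'k) monoid"
  assume "\<not> ?thesis"
  then have eq: "monomial n a = (monomial n b :: (nat \<Rightarrow> 'k) \<Rightarrow> 'k)"
    unfolding monomial_def by (intro ext prod.cong) auto
  have "comm_monoid ?M"
    by (rule monoid.monoid_comm_monoidI[OF monoid_affine_monoid[OF assms(1)]])
      (auto simp: affine_monoid_def eq fun_eq_iff mult.commute add.commute)
  then show False using assms(2) by contradiction
qed

text \<open>
  Commutation of \<open>x\<close> and \<open>y\<close> is an equation between the last coordinates.  Test elements \<open>y\<close>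
  with the value \<open>u\<close> at \<open>i0\<close>, \<open>z\<close> at \<open>n\<close> and \<open>1\<close> elsewhere are enough: \<open>z = u = 1\<close> gives
  \<open>x\<^sup>a = x\<^sup>b\<close>, and \<open>z = 0\<close>, \<open>u = 2\<close> gives \<open>x n = 0\<close>, because \<open>2 ^ a i0 \<noteq> 2 ^ b i0\<close> in
  characteristic zero.
\<close>

lemma center_affine_monoid:
  fixes a b :: "nat \<Rightarrow> nat"
  assumes "i0 \<in> {1..<n}" "a i0 \<noteq> b i0"
  shows "monoid_center (affine_monoid n a b :: (nat \<Rightarrow> 'k::field_char_0) monoid) = binomial_locus n a b"
proof -
  let ?M = "affine_monoid n a b :: (nat \<Rightarrow> 'k) monoid"
  have comm: "x \<otimes>\<^bsub>?M\<^esub> y = y \<otimes>\<^bsub>?M\<^esub> x \<longleftrightarrow>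
      monomial n a x * y n + monomial n b y * x n = monomial n a y * x n + monomial n b x * y n" for x y
    using assms(1)
    by (auto simp: affine_monoid_def fun_eq_iff mult.commute)
  have carrier: "carrier ?M = affine_space n" by (simp add: affine_monoid_def)
  have mon: "monomial n d (\<lambda>i\<in>{1..n}. if i = n then z else if i = i0 then u else 1) = u ^ d i0"
    for d and z u :: 'k
  proof -
    have "monomial n d (\<lambda>i\<in>{1..n}. if i = n then z else if i = i0 then u else 1)
        = (\<Prod>i\<in>{1..<n}. if i = i0 then u ^ d i else 1)"
      unfolding monomial_def by (rule prod.cong) auto
    then show ?thesis using assms(1) by simp
  qed
  have "x \<in> binomial_locus n a b" if x: "x \<in> monoid_center ?M" for x
  proof -
    have test: "monomial n a x * z + u ^ b i0 * x n = u ^ a i0 * x n + monomial n b x * z" for z u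
    proof -
      let ?y = "\<lambda>i\<in>{1..n}. if i = n then z else if i = i0 then u else 1"
      have "?y \<in> affine_space n" by (auto simp: affine_space_def)
      then have "x \<otimes>\<^bsub>?M\<^esub> ?y = ?y \<otimes>\<^bsub>?M\<^esub> x" using x by (simp add: monoid_center_def carrier)
      then show ?thesis using assms(1) unfolding comm mon by simp
    qed
    have "monomial n a x = monomial n b x" using test[of 1 1] by (simp add: add.commute)
    moreover have "(2::'k) ^ b i0 \<noteq> 2 ^ a i0" unfolding two_power_eq_iff using assms(2) by simp
    then have "x n = 0" using test[of 0 2] by simp
    ultimately show ?thesis using x by (simp add: monoid_center_def carrier binomial_locus_def)
  qed
  moreover have "x \<in> monoid_center ?M" if "x \<in> binomial_locus n a b" for x
    using that by (simp add: monoid_center_def carrier comm binomial_locus_def)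
  ultimately show ?thesis by blast
qed

theorem corollary4:
  fixes n :: nat and a b :: "nat \<Rightarrow> nat"
    and M :: "(nat \<Rightarrow> 'k :: {alg_closed_field, field_char_0}) monoid"
  assumes "n \<ge> 1"
    and "M = affine_monoid n a b"
    and "\<not> comm_monoid M"
  shows "monoid_center M = {x \<in> affine_space n. x n = 0 \<and> monomial n a x = monomial n b x} \<and>
         (\<forall>C \<in> irreducible_components (subtopology (zariski n) (monoid_center M)).
           krull_dim (subtopology (zariski n) C) + 2 = enat n)"
proof -
  obtain i0 where i0: "i0 \<in> {1..<n}" "a i0 \<noteq> b i0"
    using noncommutative_exponents_differ assms by blast
  have center: "monoid_center M = binomial_locus n a b"
    unfolding assms(2) using i0 by (rule center_affine_monoid)
  have "krull_dim (subtopology (zariski n) C) + 2 = enat n"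
    if C: "C \<in> irreducible_components (subtopology (zariski n) (monoid_center M))" for C
  proof (cases "b i0 < a i0")
    case True
    with i0(1) show ?thesis using C unfolding center by (rule binomial_locus_component_dim)
  next
    case False
    then have "a i0 < b i0" using i0(2) by simp
    with i0(1) show ?thesis
      using C unfolding center binomial_locus_commute[of n a b] by (rule binomial_locus_component_dim)
  qed
  with center show ?thesis unfolding binomial_locus_def by blast
qed

end
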